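(* Let $p$ be an odd prime. Suppose that $\alpha\in\mathbb Z_p$ with $\langle-\alpha\rangle_p$ even, and that $z\in\mathbb Z_p^\times$ with $z-1$ prime to $p$. Then $$ {}_2F_1\bigg[\begin{matrix}\alpha&\alpha\\&1\end{matrix}\bigg|\,z\bigg]_{p-1}-z^{1-\lambda_p(\alpha)}{}_2F_1\bigg[\begin{matrix}\alpha&\alpha\\&1\end{matrix}\bigg|\,\frac{1}{z}\bigg]_{p-1}\equiv(1-z)^{1-\lambda_p(\alpha)}{}_2F_1\bigg[\begin{matrix}\frac12\alpha&\frac12-\frac12\alpha\\&1\end{matrix}\bigg|\,-\frac{4z}{(1-z)^2}\bigg]_{p-1}\pmod{p^2}. $$
   Context: $\mathbb Z_p$ denotes the $p$-adic integers and $\mathbb Z_p^\times$ its units. For $\alpha\in\mathbb Z_p$, $\langle\alpha\rangle_p$ is the unique integer in $\{0,1,\ldots,p-1\}$ congruent to $\alpha$ modulo $p$, and $\lambda_p(\alpha):=-\langle-\alpha\rangle_p+\frac{\alpha+\langle-\alpha\rangle_p}{p}\cdot(p-1)$. For $a\in\mathbb Z$, $s\in\mathbb Z_p$ and $w\in\mathbb Z_p^\times$, the power $w^{a+s(p-1)}$ is defined as $w^{a}\sum_{k=0}^\infty\binom{s}{k}(w^{p-1}-1)^k$ (this is well defined); in particular $w^{1-\lambda_p(\alpha)}$ is defined for $w\in\mathbb Z_p^\times$. Pochhammer symbol: $(x)_0=1$, $(x)_k=x(x+1)\cdots(x+k-1)$. For $n\ge 0$, ${}_{2}F_1\Big[\begin{matrix}\alpha&\beta\\&\gamma\end{matrix}\Big|\,z\Big]_n=\sum_{k=0}^{n}\frac{(\alpha)_k(\beta)_k}{(\gamma)_k}\cdot\frac{z^k}{k!}$.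 For $x,y\in\mathbb Z_p$, $x\equiv y\pmod{p^2}$ means $x-y\in p^2\mathbb Z_p$. *)

theory Defs
  imports Complex_Main "HOL-Library.Product_Plus" "Berlekamp_Zassenhaus.Finite_Field"
begin

section \<open>The $p$-adic absolute value on the rationals\<close>

definition padic_abs :: "nat \<Rightarrow> rat \<Rightarrow> real" where
  "padic_abs p r = (if r = 0 then 0 else
     real p powi (int (multiplicity (int p) (snd (quotient_of r)))
                - int (multiplicity (int p) (fst (quotient_of r)))))"

lemma padic_abs_0 [simp]: "padic_abs p 0 = 0"
  by (simp add: padic_abs_def)

lemma padic_abs_of_int_divide:
  assumes p: "prime p" and a: "a \<noteq> 0" and b: "b \<noteq> 0"
  shows "padic_abs p (of_int a / of_int b)
    = real p powi (int (multiplicity (int p) b) - int (multiplicity (int p) a))"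
proof -
  define r :: rat where "r = of_int a / of_int b"
  obtain c d where cd: "quotient_of r = (c, d)" by (cases "quotient_of r")
  have d: "d > 0" using quotient_of_denom_pos[OF cd] .
  have r: "r = of_int c / of_int d" using quotient_of_div[OF cd] .
  have "r \<noteq> 0" using a b by (simp add: r_def)
  with r have c: "c \<noteq> 0" by auto
  have "of_int a * of_int d = (of_int c * of_int b :: rat)"
    using r b d unfolding r_def by (simp add: field_simps)
  then have eq: "a * d = c * b" by (metis of_int_eq_iff of_int_mult)
  have pe: "prime_elem (int p)" using p by simp
  have "multiplicity (int p) a + multiplicity (int p) d = multiplicity (int p) c + multiplicity (int p) b"
    using prime_elem_multiplicity_mult_distrib[OF pe, of a d]
      prime_elem_multiplicity_mult_distrib[OF pe, of c b] a b c d eq by simp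
  then have "int (multiplicity (int p) d) - int (multiplicity (int p) c)
      = int (multiplicity (int p) b) - int (multiplicity (int p) a)" by linarith
  then show ?thesis using \<open>r \<noteq> 0\<close> cd unfolding r_def[symmetric] by (simp add: padic_abs_def)
qed

lemma padic_abs_nonneg [simp]: "0 \<le> padic_abs p r"
  by (simp add: padic_abs_def)

lemma padic_abs_eq_0_iff [simp]: "prime p \<Longrightarrow> padic_abs p r = 0 \<longleftrightarrow> r = 0"
  by (auto simp: padic_abs_def power_int_eq_0_iff prime_gt_0_nat)

lemma padic_abs_1 [simp]: "padic_abs p 1 = 1"
  by (simp add: padic_abs_def)

lemma padic_abs_minus [simp]: "padic_abs p (- r) = padic_abs p r"
proof -
  have "multiplicity (int p) (- a) = multiplicity (int p) a" for a
    using multiplicity_times_unit_right[of "-1" "int p" a] by simp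
  then show ?thesis
    by (simp add: padic_abs_def rat_uminus_code Let_def split: prod.splits)
qed

lemma padic_abs_minus_commute: "padic_abs p (r - s) = padic_abs p (s - r)"
  using padic_abs_minus[of p "r - s"] by simp

lemma rat_eq_of_int_divide:
  fixes r :: rat
  obtains a b where "r = of_int a / of_int b" "b \<noteq> 0"
  by (metis quotient_of_denom_pos quotient_of_div less_irrefl prod.collapse)

lemma padic_abs_mult:
  assumes p: "prime p"
  shows "padic_abs p (r * s) = padic_abs p r * padic_abs p s"
proof (cases "r = 0 \<or> s = 0")
  case False
  obtain a b where r: "r = of_int a / of_int b" and b: "b \<noteq> 0" by (rule rat_eq_of_int_divide)
  obtain c d where s: "s = of_int c / of_int d" and d: "d \<noteq> 0" by (rule rat_eq_of_int_divide)
  from False r s have ac: "a \<noteq> 0" "c \<noteq> 0" by auto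
  have pe: "prime_elem (int p)" using p by simp
  have rs: "r * s = of_int (a * c) / of_int (b * d)" by (simp add: r s)
  show ?thesis
    unfolding rs unfolding r s using ac b d p
    by (simp add: padic_abs_of_int_divide prime_elem_multiplicity_mult_distrib[OF pe]
        power_int_add[symmetric] prime_gt_0_nat del: of_int_mult)
       (simp add: algebra_simps)
qed auto

lemma padic_abs_inverse:
  assumes "prime p" shows "padic_abs p (inverse r) = inverse (padic_abs p r)"
proof (cases "r = 0")
  case False
  then have "padic_abs p r * padic_abs p (inverse r) = 1"
    using padic_abs_mult[OF assms, of r "inverse r"] by simp
  then show ?thesis using inverse_unique by metis
qed simp

lemma padic_abs_add_le_max:
  assumes p: "prime p"
  shows "padic_abs p (r + s) \<le> max (padic_abs p r) (padic_abs p s)"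
proof (cases "r = 0 \<or> s = 0 \<or> r + s = 0")
  case True
  then show ?thesis by (auto simp: le_max_iff_disj)
next
  case False
  obtain a b where r: "r = of_int a / of_int b" and b: "b \<noteq> 0" by (rule rat_eq_of_int_divide)
  obtain c d where s: "s = of_int c / of_int d" and d: "d \<noteq> 0" by (rule rat_eq_of_int_divide)
  let ?v = "multiplicity (int p)"
  have pu: "\<not> is_unit (int p)" using p by auto
  have r': "r = of_int (a * d) / of_int (b * d)" and s': "s = of_int (c * b) / of_int (b * d)"
    using b d by (simp_all add: r s)
  have rs: "r + s = of_int (a * d + c * b) / of_int (b * d)"
    unfolding r' s' by (simp add: add_divide_distrib)
  have nz: "a * d \<noteq> 0" "c * b \<noteq> 0" "a * d + c * b \<noteq> 0" "b * d \<noteq> 0"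
    using False b d unfolding rs unfolding r s by (auto simp del: of_int_mult of_int_add)
  define k where "k = min (?v (a * d)) (?v (c * b))"
  have "int p ^ k dvd a * d + c * b"
    by (intro dvd_add multiplicity_dvd') (auto simp: k_def)
  then have "k \<le> ?v (a * d + c * b)" using multiplicity_geI[OF _ pu] nz by blast
  moreover have "real p \<ge> 1" using prime_ge_1_nat[OF p] by simp
  ultimately have "real p powi (int (?v (b * d)) - int (?v (a * d + c * b)))
      \<le> real p powi (int (?v (b * d)) - int k)"
    by (intro power_int_increasing) auto
  also have "\<dots> \<le> max (padic_abs p r) (padic_abs p s)"
    unfolding r' s' padic_abs_of_int_divide[OF p nz(1,4)] padic_abs_of_int_divide[OF p nz(2,4)]
    by (auto simp: k_def min_def le_max_iff_disj)
  finally show ?thesis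
    unfolding rs padic_abs_of_int_divide[OF p nz(3,4)] .
qed

lemma padic_abs_add_le:
  assumes "prime p" shows "padic_abs p (r + s) \<le> padic_abs p r + padic_abs p s"
  using padic_abs_add_le_max[OF assms, of r s] padic_abs_nonneg[of p r] padic_abs_nonneg[of p s]
  by linarith

lemma padic_abs_diff_le:
  assumes "prime p" shows "\<bar>padic_abs p r - padic_abs p s\<bar> \<le> padic_abs p (r - s)"
  using padic_abs_add_le[OF assms, of "r - s" s] padic_abs_add_le[OF assms, of "s - r" r]
    padic_abs_minus_commute[of p r s] by simp


section \<open>Cauchy sequences of rationals\<close>

definition padic_vanishes :: "nat \<Rightarrow> (nat \<Rightarrow> rat) \<Rightarrow> bool" where
  "padic_vanishes p X \<longleftrightarrow> (\<lambda>n. padic_abs p (X n)) \<longlonglongrightarrow> 0"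

definition padic_cauchy :: "nat \<Rightarrow> (nat \<Rightarrow> rat) \<Rightarrow> bool" where
  "padic_cauchy p X \<longleftrightarrow> (\<forall>e>0. \<exists>M. \<forall>m\<ge>M. \<forall>n\<ge>M. padic_abs p (X m - X n) < e)"

context
  fixes p :: nat
  assumes p: "prime p"
begin

lemma padic_vanishes_const: "padic_vanishes p (\<lambda>n. c) \<longleftrightarrow> c = 0"
  by (simp add: padic_vanishes_def LIMSEQ_const_iff p)

lemma padic_vanishes_minus: "padic_vanishes p X \<Longrightarrow> padic_vanishes p (\<lambda>n. - X n)"
  by (simp add: padic_vanishes_def)

lemma padic_vanishes_le:
  assumes "padic_vanishes p X" "\<forall>\<^sub>F n in sequentially. padic_abs p (Y n) \<le> C * padic_abs p (X n)"
  shows "padic_vanishes p Y"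
proof -
  have "(\<lambda>n. C * padic_abs p (X n)) \<longlonglongrightarrow> C * 0"
    using assms(1) unfolding padic_vanishes_def by (rule tendsto_mult[OF tendsto_const])
  then have lim: "(\<lambda>n. C * padic_abs p (X n)) \<longlonglongrightarrow> 0" by simp
  show ?thesis
    unfolding padic_vanishes_def
    by (rule tendsto_sandwich[OF _ assms(2) tendsto_const lim]) simp
qed

lemma padic_vanishes_add:
  assumes "padic_vanishes p X" "padic_vanishes p Y"
  shows "padic_vanishes p (\<lambda>n. X n + Y n)"
proof -
  have "(\<lambda>n. padic_abs p (X n) + padic_abs p (Y n)) \<longlonglongrightarrow> 0 + 0"
    using assms unfolding padic_vanishes_def by (rule tendsto_add)
  then have lim: "(\<lambda>n. padic_abs p (X n) + padic_abs p (Y n)) \<longlonglongrightarrow> 0" by simp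
  show ?thesis
    unfolding padic_vanishes_def
    by (rule tendsto_sandwich[OF _ _ tendsto_const lim]) (simp_all add: padic_abs_add_le p)
qed

lemma padic_vanishes_diff:
  assumes "padic_vanishes p X" "padic_vanishes p Y"
  shows "padic_vanishes p (\<lambda>n. X n - Y n)"
  using padic_vanishes_add[OF assms(1) padic_vanishes_minus[OF assms(2)]] by simp

lemma padic_cauchy_const: "padic_cauchy p (\<lambda>n. c)"
  by (simp add: padic_cauchy_def)

lemma padic_cauchy_minus: "padic_cauchy p X \<Longrightarrow> padic_cauchy p (\<lambda>n. - X n)"
  unfolding padic_cauchy_def minus_diff_minus padic_abs_minus .

lemma padic_cauchy_add:
  assumes X: "padic_cauchy p X" and Y: "padic_cauchy p Y"
  shows "padic_cauchy p (\<lambda>n. X n + Y n)"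
  unfolding padic_cauchy_def
proof (intro allI impI)
  fix e :: real assume "e > 0"
  then obtain M N where M: "\<forall>m\<ge>M. \<forall>n\<ge>M. padic_abs p (X m - X n) < e"
    and N: "\<forall>m\<ge>N. \<forall>n\<ge>N. padic_abs p (Y m - Y n) < e"
    using X Y unfolding padic_cauchy_def by meson
  have "padic_abs p (X m + Y m - (X n + Y n)) < e" if "m \<ge> max M N" "n \<ge> max M N" for m n
  proof -
    have "padic_abs p (X m - X n) < e" "padic_abs p (Y m - Y n) < e" using M N that by auto
    then show ?thesis
      using padic_abs_add_le_max[OF p, of "X m - X n" "Y m - Y n"] unfolding add_diff_add by linarith
  qed
  then show "\<exists>M. \<forall>m\<ge>M. \<forall>n\<ge>M. padic_abs p (X m + Y m - (X n + Y n)) < e" by blast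
qed

lemma padic_cauchy_diff:
  assumes "padic_cauchy p X" "padic_cauchy p Y"
  shows "padic_cauchy p (\<lambda>n. X n - Y n)"
  using padic_cauchy_add[OF assms(1) padic_cauchy_minus[OF assms(2)]] by simp

lemma padic_cauchy_convergent:
  assumes "padic_cauchy p X" shows "convergent (\<lambda>n. padic_abs p (X n))"
proof -
  have "Cauchy (\<lambda>n. padic_abs p (X n))"
    unfolding Cauchy_def dist_real_def
    using assms order_le_less_trans[OF padic_abs_diff_le[OF p]] unfolding padic_cauchy_def by fast
  then show ?thesis by (rule Cauchy_convergent)
qed

lemma padic_cauchy_bounded:
  assumes "padic_cauchy p X" shows "\<exists>b>0. \<forall>n. padic_abs p (X n) \<le> b"
  using convergent_imp_Bseq[OF padic_cauchy_convergent[OF assms]] by (auto simp: Bseq_def)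

lemma padic_cauchy_mult:
  assumes X: "padic_cauchy p X" and Y: "padic_cauchy p Y"
  shows "padic_cauchy p (\<lambda>n. X n * Y n)"
  unfolding padic_cauchy_def
proof (intro allI impI)
  fix e :: real assume e: "e > 0"
  obtain a where a: "a > 0" "\<forall>n. padic_abs p (X n) \<le> a" using padic_cauchy_bounded[OF X] by blast
  obtain b where b: "b > 0" "\<forall>n. padic_abs p (Y n) \<le> b" using padic_cauchy_bounded[OF Y] by blast
  have "e / b > 0" "e / a > 0" using a b e by auto
  then obtain M N where M: "\<forall>m\<ge>M. \<forall>n\<ge>M. padic_abs p (X m - X n) < e / b"
    and N: "\<forall>m\<ge>N. \<forall>n\<ge>N. padic_abs p (Y m - Y n) < e / a"
    using X Y unfolding padic_cauchy_def by meson
  have "padic_abs p (X m * Y m - X n * Y n) < e" if mn: "m \<ge> max M N" "n \<ge> max M N" for m n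
  proof -
    have "padic_abs p (X m) * padic_abs p (Y m - Y n) \<le> a * padic_abs p (Y m - Y n)"
      using a by (intro mult_right_mono) auto
    also have "\<dots> < a * (e / a)" using N mn a by (intro mult_strict_left_mono) auto
    finally have 1: "padic_abs p (X m * (Y m - Y n)) < e" using a by (simp add: padic_abs_mult p)
    have "padic_abs p (X m - X n) * padic_abs p (Y n) \<le> padic_abs p (X m - X n) * b"
      using b by (intro mult_left_mono) auto
    also have "\<dots> < e / b * b" using M mn b by (intro mult_strict_right_mono) auto
    finally have 2: "padic_abs p ((X m - X n) * Y n) < e" using b by (simp add: padic_abs_mult p)
    show ?thesis
      using padic_abs_add_le_max[OF p, of "X m * (Y m - Y n)" "(X m - X n) * Y n"] 1 2
      unfolding mult_diff_mult by linarith
  qed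
  then show "\<exists>M. \<forall>m\<ge>M. \<forall>n\<ge>M. padic_abs p (X m * Y m - X n * Y n) < e" by blast
qed

lemma padic_cauchy_not_vanishes:
  assumes X: "padic_cauchy p X" and nz: "\<not> padic_vanishes p X"
  obtains b where "b > 0" "\<forall>\<^sub>F n in sequentially. padic_abs p (X n) > b"
proof -
  obtain L where L: "(\<lambda>n. padic_abs p (X n)) \<longlonglongrightarrow> L"
    using padic_cauchy_convergent[OF X] by (auto simp: convergent_def)
  have "L \<ge> 0" using L by (rule LIMSEQ_le_const) auto
  moreover have "L \<noteq> 0" using nz L by (auto simp: padic_vanishes_def)
  ultimately have "L / 2 > 0" "L > L / 2" by auto
  then show ?thesis using that order_tendstoD(1)[OF L] by blast
qed

lemma padic_abs_inverse_diff_le: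
  assumes "b > 0" "c > 0" "padic_abs p x > b" "padic_abs p y > c"
  shows "padic_abs p (inverse x - inverse y) \<le> inverse (b * c) * padic_abs p (x - y)"
proof -
  have nz: "x \<noteq> 0" "y \<noteq> 0" using assms by auto
  have "padic_abs p (inverse x - inverse y)
      = inverse (padic_abs p x * padic_abs p y) * padic_abs p (x - y)"
    using nz by (simp add: inverse_diff_inverse padic_abs_mult padic_abs_inverse p)
  also have "\<dots> \<le> inverse (b * c) * padic_abs p (x - y)"
    using assms by (intro mult_right_mono le_imp_inverse_le mult_mono) auto
  finally show ?thesis .
qed

lemma padic_cauchy_inverse:
  assumes X: "padic_cauchy p X" and nz: "\<not> padic_vanishes p X"
  shows "padic_cauchy p (\<lambda>n. inverse (X n))"
  unfolding padic_cauchy_def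
proof (intro allI impI)
  fix e :: real assume e: "e > 0"
  obtain b N where b: "b > 0" and N: "\<forall>n\<ge>N. padic_abs p (X n) > b"
    using padic_cauchy_not_vanishes[OF X nz] unfolding eventually_sequentially by metis
  have "e * (b * b) > 0" using b e by simp
  then obtain M where M: "\<forall>m\<ge>M. \<forall>n\<ge>M. padic_abs p (X m - X n) < e * (b * b)"
    using X unfolding padic_cauchy_def by meson
  have "padic_abs p (inverse (X m) - inverse (X n)) < e" if "m \<ge> max M N" "n \<ge> max M N" for m n
  proof -
    have "padic_abs p (inverse (X m) - inverse (X n)) \<le> inverse (b * b) * padic_abs p (X m - X n)"
      using that N b by (intro padic_abs_inverse_diff_le) auto
    also have "\<dots> < inverse (b * b) * (e * (b * b))"
      using that M b by (intro mult_strict_left_mono) auto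
    also have "\<dots> = e" using b by (simp add: field_simps)
    finally show ?thesis .
  qed
  then show "\<exists>M. \<forall>m\<ge>M. \<forall>n\<ge>M. padic_abs p (inverse (X m) - inverse (X n)) < e" by blast
qed

lemma padic_vanishes_diff_inverse:
  assumes X: "padic_cauchy p X" "\<not> padic_vanishes p X"
    and Y: "padic_cauchy p Y" "\<not> padic_vanishes p Y"
    and XY: "padic_vanishes p (\<lambda>n. X n - Y n)"
  shows "padic_vanishes p (\<lambda>n. inverse (X n) - inverse (Y n))"
proof -
  obtain b where b: "b > 0" "\<forall>\<^sub>F n in sequentially. padic_abs p (X n) > b"
    using padic_cauchy_not_vanishes[OF X] .
  obtain c where c: "c > 0" "\<forall>\<^sub>F n in sequentially. padic_abs p (Y n) > c"
    using padic_cauchy_not_vanishes[OF Y] .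
  have "\<forall>\<^sub>F n in sequentially. padic_abs p (inverse (X n) - inverse (Y n))
      \<le> inverse (b * c) * padic_abs p (X n - Y n)"
    using b(2) c(2) by eventually_elim (rule padic_abs_inverse_diff_le[OF b(1) c(1)])
  then show ?thesis by (rule padic_vanishes_le[OF XY])
qed

lemma padic_vanishes_mult:
  assumes "padic_cauchy p X" "padic_vanishes p Y"
  shows "padic_vanishes p (\<lambda>n. X n * Y n)"
proof -
  obtain b where "b > 0" "\<forall>n. padic_abs p (X n) \<le> b" using padic_cauchy_bounded[OF assms(1)] by blast
  then have "\<forall>\<^sub>F n in sequentially. padic_abs p (X n * Y n) \<le> b * padic_abs p (Y n)"
    by (intro always_eventually) (auto simp: padic_abs_mult p intro!: mult_right_mono)
  then show ?thesis by (rule padic_vanishes_le[OF assms(2)])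
qed

end


section \<open>The field of $p$-adic numbers\<close>

text \<open>
  The completion of the rationals with respect to the $p$-adic absolute value: Cauchy sequences
  modulo null sequences. The prime is carried by the type: elements of \<open>'p padic\<close> are
  $p$-adic numbers for $p$ the cardinality of \<open>'p\<close>, and the class \<^class>\<open>prime_card\<close>
  says that this cardinality is prime.
\<close>

lemmas CARD_prime = prime_card[where 'a = "'p::prime_card"]

typedef (overloaded) 'p padic_seq = "{X. padic_cauchy CARD('p::prime_card) X}"
  using padic_cauchy_const[OF CARD_prime] by blast

setup_lifting type_definition_padic_seq

instantiation padic_seq :: (prime_card) comm_ring_1
begin

lift_definition zero_padic_seq :: "'a padic_seq" is "\<lambda>n. 0"
  by (rule padic_cauchy_const[OF CARD_prime])

lift_definition one_padic_seq :: "'a padic_seq" is "\<lambda>n. 1"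
  by (rule padic_cauchy_const[OF CARD_prime])

lift_definition plus_padic_seq :: "'a padic_seq \<Rightarrow> 'a padic_seq \<Rightarrow> 'a padic_seq"
  is "\<lambda>X Y n. X n + Y n" by (rule padic_cauchy_add[OF CARD_prime])

lift_definition minus_padic_seq :: "'a padic_seq \<Rightarrow> 'a padic_seq \<Rightarrow> 'a padic_seq"
  is "\<lambda>X Y n. X n - Y n" by (rule padic_cauchy_diff[OF CARD_prime])

lift_definition uminus_padic_seq :: "'a padic_seq \<Rightarrow> 'a padic_seq"
  is "\<lambda>X n. - X n" by (rule padic_cauchy_minus[OF CARD_prime])

lift_definition times_padic_seq :: "'a padic_seq \<Rightarrow> 'a padic_seq \<Rightarrow> 'a padic_seq"
  is "\<lambda>X Y n. X n * Y n" by (rule padic_cauchy_mult[OF CARD_prime])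

instance
proof
  fix X Y Z :: "'a padic_seq"
  show "X + Y + Z = X + (Y + Z)" by transfer (simp add: add.assoc)
  show "X + Y = Y + X" by transfer (simp add: add.commute)
  show "0 + X = X" by transfer simp
  show "- X + X = 0" by transfer simp
  show "X - Y = X + - Y" by transfer simp
  show "X * Y * Z = X * (Y * Z)" by transfer (simp add: mult.assoc)
  show "X * Y = Y * X" by transfer (simp add: mult.commute)
  show "1 * X = X" by transfer simp
  show "(X + Y) * Z = X * Z + Y * Z" by transfer (simp add: distrib_right)
  have "(\<lambda>n::nat. 0::rat) \<noteq> (\<lambda>n. 1)" by (simp add: fun_eq_iff)
  then show "(0 :: 'a padic_seq) \<noteq> 1" by transfer
qed

end

lift_definition padic_null :: "'p::prime_card padic_seq \<Rightarrow> bool" is "padic_vanishes CARD('p)" .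

lift_definition padic_seq_inverse :: "'p::prime_card padic_seq \<Rightarrow> 'p padic_seq"
  is "\<lambda>X. if padic_vanishes CARD('p) X then (\<lambda>n. 0) else (\<lambda>n. inverse (X n))"
  by (auto intro: padic_cauchy_inverse[OF CARD_prime] padic_cauchy_const[OF CARD_prime])

lift_definition padic_seq_const :: "rat \<Rightarrow> 'p::prime_card padic_seq" is "\<lambda>r n. r"
  by (rule padic_cauchy_const[OF CARD_prime])

lift_definition padic_seq_norm :: "'p::prime_card padic_seq \<Rightarrow> real"
  is "\<lambda>X. lim (\<lambda>n. padic_abs CARD('p) (X n))" .

lemma padic_null_0 [simp]: "padic_null 0"
  by transfer (simp add: padic_vanishes_const[OF CARD_prime])

lemma padic_null_const [simp]: "padic_null (padic_seq_const r :: 'p::prime_card padic_seq) \<longleftrightarrow> r = 0"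
  by transfer (simp add: padic_vanishes_const[OF CARD_prime])

lemma padic_null_minus: "padic_null X \<Longrightarrow> padic_null (- X)"
  by transfer (rule padic_vanishes_minus[OF CARD_prime])

lemma padic_null_add: "padic_null X \<Longrightarrow> padic_null Y \<Longrightarrow> padic_null (X + Y)"
  by transfer (rule padic_vanishes_add[OF CARD_prime])

lemma padic_null_diff: "padic_null X \<Longrightarrow> padic_null Y \<Longrightarrow> padic_null (X - Y)"
  by transfer (rule padic_vanishes_diff[OF CARD_prime])

lemma padic_null_mult: "padic_null Y \<Longrightarrow> padic_null (X * Y)"
  by transfer (rule padic_vanishes_mult[OF CARD_prime])

lemma padic_null_inverse_mult:
  "\<not> padic_null X \<Longrightarrow> padic_null (padic_seq_inverse X * X - 1)"
proof transfer
  fix X :: "nat \<Rightarrow> rat"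
  assume X: "padic_cauchy CARD('a) X" "\<not> padic_vanishes CARD('a) X"
  then obtain b where "b > 0" and ev: "\<forall>\<^sub>F n in sequentially. padic_abs CARD('a) (X n) > b"
    by (rule padic_cauchy_not_vanishes[OF CARD_prime])
  have "padic_abs CARD('a) (inverse (X n) * X n - 1) = 0" if "padic_abs CARD('a) (X n) > b" for n
  proof -
    have "X n \<noteq> 0" using that \<open>b > 0\<close> by auto
    then show ?thesis by simp
  qed
  then have "\<forall>\<^sub>F n in sequentially. padic_abs CARD('a) (inverse (X n) * X n - 1) = 0"
    using ev by (rule eventually_mono[rotated])
  then show "padic_vanishes CARD('a)
      (\<lambda>n. (if padic_vanishes CARD('a) X then \<lambda>n. 0 else (\<lambda>n. inverse (X n))) n * X n - 1)"
    using X by (simp add: padic_vanishes_def tendsto_eventually)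
qed

lemma padic_null_diff_inverse:
  assumes "padic_null (X - Y)"
  shows "padic_null (padic_seq_inverse X - padic_seq_inverse Y)"
proof -
  have "padic_null X \<longleftrightarrow> padic_null Y"
    using padic_null_add[of "X - Y" Y] padic_null_diff[of X "X - Y"] assms by auto
  with assms show ?thesis
  proof transfer
    fix X Y :: "nat \<Rightarrow> rat"
    assume XY: "padic_cauchy CARD('a) X" "padic_cauchy CARD('a) Y"
        "padic_vanishes CARD('a) (\<lambda>n. X n - Y n)"
      and iff: "padic_vanishes CARD('a) X \<longleftrightarrow> padic_vanishes CARD('a) Y"
    show "padic_vanishes CARD('a)
        (\<lambda>n. (if padic_vanishes CARD('a) X then \<lambda>n. 0 else (\<lambda>n. inverse (X n))) n
           - (if padic_vanishes CARD('a) Y then \<lambda>n. 0 else (\<lambda>n. inverse (Y n))) n)"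
    proof (cases "padic_vanishes CARD('a) Y")
      case True
      with iff show ?thesis by (simp add: padic_vanishes_const[OF CARD_prime])
    next
      case False
      with iff padic_vanishes_diff_inverse[OF CARD_prime XY(1) _ XY(2) _ XY(3)] show ?thesis
        by simp
    qed
  qed
qed

lemma padic_seq_norm_LIMSEQ:
  "(\<lambda>n. padic_abs CARD('p) (Rep_padic_seq X n)) \<longlonglongrightarrow> padic_seq_norm (X :: 'p::prime_card padic_seq)"
  unfolding padic_seq_norm.rep_eq convergent_LIMSEQ_iff[symmetric]
  using Rep_padic_seq[of X] by (intro padic_cauchy_convergent CARD_prime) simp

lemma padic_seq_norm_eq_0_iff: "padic_seq_norm X = 0 \<longleftrightarrow> padic_null X"
  unfolding padic_null.rep_eq padic_vanishes_def
  using padic_seq_norm_LIMSEQ[of X] LIMSEQ_unique by metis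

lemma padic_seq_norm_nonneg: "padic_seq_norm X \<ge> 0"
  using padic_seq_norm_LIMSEQ[of X] by (rule LIMSEQ_le_const) auto

lemma padic_seq_norm_minus [simp]: "padic_seq_norm (- X) = padic_seq_norm X"
  by transfer simp

lemma padic_seq_norm_const [simp]:
  "padic_seq_norm (padic_seq_const r :: 'p::prime_card padic_seq) = padic_abs CARD('p) r"
  by transfer simp

lemma padic_seq_norm_mult: "padic_seq_norm (X * Y) = padic_seq_norm X * padic_seq_norm Y"
  using padic_seq_norm_LIMSEQ[of "X * Y"]
  unfolding times_padic_seq.rep_eq padic_abs_mult[OF CARD_prime]
  by (rule LIMSEQ_unique[OF _ tendsto_mult[OF padic_seq_norm_LIMSEQ padic_seq_norm_LIMSEQ]])

lemma padic_seq_norm_add_le_max: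
  "padic_seq_norm (X + Y) \<le> max (padic_seq_norm X) (padic_seq_norm Y)"
  by (rule LIMSEQ_le[OF padic_seq_norm_LIMSEQ[of "X + Y"]
        tendsto_max[OF padic_seq_norm_LIMSEQ[of X] padic_seq_norm_LIMSEQ[of Y]]])
     (auto simp: plus_padic_seq.rep_eq padic_abs_add_le_max[OF CARD_prime])

lemma padic_seq_norm_diff_null:
  assumes "padic_null (X - Y)" shows "padic_seq_norm X = padic_seq_norm Y"
proof (rule antisym)
  have 0: "padic_seq_norm (X - Y) = 0" using assms by (simp add: padic_seq_norm_eq_0_iff)
  show "padic_seq_norm X \<le> padic_seq_norm Y"
    using padic_seq_norm_add_le_max[of "X - Y" Y] padic_seq_norm_nonneg[of Y] 0 by simp
  have "padic_seq_norm (Y - X) = 0" using 0 padic_seq_norm_minus[of "X - Y"] by simp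
  then show "padic_seq_norm Y \<le> padic_seq_norm X"
    using padic_seq_norm_add_le_max[of "Y - X" X] padic_seq_norm_nonneg[of X] by simp
qed

quotient_type (overloaded) 'p padic = "'p::prime_card padic_seq" / "\<lambda>X Y. padic_null (X - Y)"
  morphisms rep_padic Padic
proof (rule equivpI)
  show "reflp (\<lambda>X Y :: 'p padic_seq. padic_null (X - Y))" by (simp add: reflp_def)
  show "symp (\<lambda>X Y :: 'p padic_seq. padic_null (X - Y))"
    using padic_null_minus by (fastforce simp: symp_def)
  show "transp (\<lambda>X Y :: 'p padic_seq. padic_null (X - Y))"
    using padic_null_add by (fastforce simp: transp_def)
qed

instantiation padic :: (prime_card) field
begin

lift_definition zero_padic :: "'a padic" is 0 .

lift_definition one_padic :: "'a padic" is 1 .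

lift_definition plus_padic :: "'a padic \<Rightarrow> 'a padic \<Rightarrow> 'a padic" is "(+)"
  unfolding add_diff_add by (rule padic_null_add)

lift_definition minus_padic :: "'a padic \<Rightarrow> 'a padic \<Rightarrow> 'a padic" is "(-)"
proof -
  fix X X' Y Y' :: "'a padic_seq"
  assume "padic_null (X - X')" "padic_null (Y - Y')"
  then have "padic_null ((X - X') - (Y - Y'))" by (rule padic_null_diff)
  then show "padic_null (X - Y - (X' - Y'))" by (simp add: algebra_simps)
qed

lift_definition uminus_padic :: "'a padic \<Rightarrow> 'a padic" is uminus
  unfolding minus_diff_minus by (rule padic_null_minus)

lift_definition times_padic :: "'a padic \<Rightarrow> 'a padic \<Rightarrow> 'a padic" is "(*)"
proof -
  fix X X' Y Y' :: "'a padic_seq"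
  assume "padic_null (X - X')" "padic_null (Y - Y')"
  then have "padic_null (X * (Y - Y') + Y' * (X - X'))"
    by (intro padic_null_add padic_null_mult)
  then show "padic_null (X * Y - X' * Y')" by (simp add: algebra_simps)
qed

lift_definition inverse_padic :: "'a padic \<Rightarrow> 'a padic" is padic_seq_inverse
  by (rule padic_null_diff_inverse)

definition divide_padic :: "'a padic \<Rightarrow> 'a padic \<Rightarrow> 'a padic" where
  "divide_padic x y = x * inverse y"

instance
proof
  fix a b c :: "'a padic"
  show "a + b + c = a + (b + c)" "a + b = b + a" "0 + a = a" "- a + a = 0" "a - b = a + - b"
    "a * b * c = a * (b * c)" "a * b = b * a" "1 * a = a" "(a + b) * c = a * c + b * c"
    by (transfer; simp add: algebra_simps)+
  have "\<not> padic_null (0 - 1 :: 'a padic_seq)"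
    by transfer (simp add: padic_vanishes_const[OF CARD_prime])
  then show "(0::'a padic) \<noteq> 1" by (simp add: zero_padic_def one_padic_def padic.abs_eq_iff)
  show "a \<noteq> 0 \<Longrightarrow> inverse a * a = 1"
    by transfer (simp add: padic_null_inverse_mult)
  show "a div b = a * inverse b" by (rule divide_padic_def)
  have "padic_seq_inverse (0 :: 'a padic_seq) = 0"
    by transfer (simp add: padic_vanishes_const[OF CARD_prime])
  then show "inverse (0 :: 'a padic) = 0" by (simp add: zero_padic_def inverse_padic.abs_eq)
qed

end

lift_definition padic_of_rat :: "rat \<Rightarrow> 'p::prime_card padic" is padic_seq_const .

lemma padic_of_rat_of_nat: "padic_of_rat (of_nat n) = (of_nat n :: 'p::prime_card padic)"
proof (induction n)
  case 0
  have "padic_seq_const 0 = (0 :: 'p padic_seq)" by transfer simp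
  then show ?case by (simp add: padic_of_rat.abs_eq zero_padic_def)
next
  case (Suc n)
  have "padic_seq_const (1 + r) = (1 + padic_seq_const r :: 'p padic_seq)" for r
    by transfer simp
  then have "padic_of_rat (1 + r) = (1 + padic_of_rat r :: 'p padic)" for r
    by (simp add: padic_of_rat.abs_eq one_padic_def plus_padic.abs_eq)
  with Suc show ?case by simp
qed

lemma padic_of_rat_eq_iff:
  "padic_of_rat r = (padic_of_rat s :: 'p::prime_card padic) \<longleftrightarrow> r = s"
proof -
  have "padic_seq_const r - padic_seq_const s = (padic_seq_const (r - s) :: 'p padic_seq)"
    by transfer simp
  then show ?thesis by (simp add: padic_of_rat.abs_eq padic.abs_eq_iff)
qed

instance padic :: (prime_card) field_char_0
proof
  show "inj (of_nat :: nat \<Rightarrow> 'a padic)"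
    by (rule injI) (metis padic_of_rat_of_nat padic_of_rat_eq_iff of_nat_eq_iff)
qed

lemma padic_of_rat_eq_of_rat: "padic_of_rat r = (of_rat r :: 'p::prime_card padic)"
proof -
  have minus: "padic_of_rat (- r) = (- padic_of_rat r :: 'p padic)" for r
  proof -
    have "padic_seq_const (- r) = (- padic_seq_const r :: 'p padic_seq)" by transfer simp
    then show ?thesis by (simp add: padic_of_rat.abs_eq uminus_padic.abs_eq)
  qed
  have mult: "padic_of_rat (r * s) = (padic_of_rat r * padic_of_rat s :: 'p padic)" for r s
  proof -
    have "padic_seq_const (r * s) = (padic_seq_const r * padic_seq_const s :: 'p padic_seq)"
      by transfer simp
    then show ?thesis by (simp add: padic_of_rat.abs_eq times_padic.abs_eq)
  qed
  have int: "padic_of_rat (of_int k) = (of_int k :: 'p padic)" for k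
    by (cases k) (simp_all only: of_int_of_nat_eq of_int_minus minus padic_of_rat_of_nat)
  obtain a b where r: "r = of_int a / of_int b" and b: "b \<noteq> 0" by (rule rat_eq_of_int_divide)
  have "padic_of_rat r * of_int b = (padic_of_rat (r * of_int b) :: 'p padic)" by (simp add: mult int)
  also have "\<dots> = of_int a" using r b by (simp add: int)
  also have "\<dots> = of_rat r * of_int b" using r b by (simp add: of_rat_divide)
  finally show ?thesis using b by simp
qed

lift_definition padic_norm :: "'p::prime_card padic \<Rightarrow> real" is padic_seq_norm
  by (rule padic_seq_norm_diff_null)

instantiation padic :: (prime_card) metric_space
begin

definition dist_padic :: "'a padic \<Rightarrow> 'a padic \<Rightarrow> real" where
  "dist_padic x y = padic_norm (x - y)"

definition uniformity_padic :: "('a padic \<times> 'a padic) filter" where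
  "uniformity_padic = (INF e\<in>{0<..}. principal {(x, y). dist x y < e})"

definition open_padic :: "'a padic set \<Rightarrow> bool" where
  "open_padic U \<longleftrightarrow> (\<forall>x\<in>U. eventually (\<lambda>(x', y). x' = x \<longrightarrow> y \<in> U) uniformity)"

instance
proof
  fix x y z :: "'a padic"
  have "padic_norm x = 0 \<longleftrightarrow> x = 0" for x :: "'a padic"
    by transfer (simp add: padic_seq_norm_eq_0_iff)
  then show "dist x y = 0 \<longleftrightarrow> x = y" by (simp add: dist_padic_def)
  have add: "padic_norm (x + y) \<le> max (padic_norm x) (padic_norm y)" for x y :: "'a padic"
    by transfer (rule padic_seq_norm_add_le_max)
  have nonneg: "padic_norm x \<ge> 0" for x :: "'a padic"
    by transfer (rule padic_seq_norm_nonneg)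
  have minus: "padic_norm (- x) = padic_norm x" for x :: "'a padic"
    by transfer simp
  have "dist x y \<le> max (padic_norm (x - z)) (padic_norm (- (y - z)))"
    using add[of "x - z" "- (y - z)"] by (simp add: dist_padic_def)
  then have "dist x y \<le> max (padic_norm (x - z)) (padic_norm (y - z))"
    by (simp only: minus)
  then show "dist x y \<le> dist x z + dist y z"
    using nonneg[of "x - z"] nonneg[of "y - z"] by (simp add: dist_padic_def)
qed (rule uniformity_padic_def open_padic_def)+

end

lemma padic_norm_nonneg [simp]: "padic_norm (x :: 'p::prime_card padic) \<ge> 0"
  by transfer (rule padic_seq_norm_nonneg)

lemma padic_norm_eq_0_iff [simp]: "padic_norm (x :: 'p::prime_card padic) = 0 \<longleftrightarrow> x = 0"
  by transfer (simp add: padic_seq_norm_eq_0_iff)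

lemma padic_norm_minus [simp]: "padic_norm (- x :: 'p::prime_card padic) = padic_norm x"
  by transfer simp

lemma padic_norm_mult: "padic_norm (x * y :: 'p::prime_card padic) = padic_norm x * padic_norm y"
  by transfer (rule padic_seq_norm_mult)

lemma padic_norm_add_le_max: "padic_norm (x + y :: 'p::prime_card padic) \<le> max (padic_norm x) (padic_norm y)"
  by transfer (rule padic_seq_norm_add_le_max)

lemma padic_norm_of_rat: "padic_norm (of_rat r :: 'p::prime_card padic) = padic_abs CARD('p) r"
  unfolding padic_of_rat_eq_of_rat[symmetric] by transfer simp

lemma padic_rat_LIMSEQ:
  fixes X :: "'p::prime_card padic_seq"
  shows "(\<lambda>n. of_rat (Rep_padic_seq X n)) \<longlonglongrightarrow> Padic X"
proof (rule metric_LIMSEQ_I)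
  fix e :: real assume "e > 0"
  then have "e / 2 > 0" by simp
  moreover have "padic_cauchy CARD('p) (Rep_padic_seq X)" using Rep_padic_seq[of X] by simp
  ultimately obtain M where M: "\<forall>m\<ge>M. \<forall>n\<ge>M.
      padic_abs CARD('p) (Rep_padic_seq X m - Rep_padic_seq X n) < e / 2"
    unfolding padic_cauchy_def by blast
  have "dist (of_rat (Rep_padic_seq X n)) (Padic X) < e" if n: "n \<ge> M" for n
  proof -
    define C :: "'p padic_seq" where "C = padic_seq_const (Rep_padic_seq X n)"
    have C: "of_rat (Rep_padic_seq X n) = Padic C"
      by (simp add: C_def padic_of_rat_eq_of_rat[symmetric] padic_of_rat.abs_eq)
    have "padic_seq_norm (C - X) \<le> e / 2"
    proof (rule LIMSEQ_le_const2[OF padic_seq_norm_LIMSEQ], intro exI allI impI)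
      fix m assume "M \<le> m"
      then show "padic_abs CARD('p) (Rep_padic_seq (C - X) m) \<le> e / 2"
        using M n by (simp add: C_def minus_padic_seq.rep_eq padic_seq_const.rep_eq less_imp_le)
    qed
    then show ?thesis
      using \<open>e > 0\<close> by (simp add: C dist_padic_def minus_padic.abs_eq padic_norm.abs_eq)
  qed
  then show "\<exists>M. \<forall>n\<ge>M. dist (of_rat (Rep_padic_seq X n)) (Padic X) < e" by blast
qed

lemma padic_rat_dense:
  fixes x :: "'p::prime_card padic"
  assumes "e > 0" obtains r where "dist x (of_rat r) < e"
proof -
  obtain X where "x = Padic X" by (metis Quotient3_def Quotient3_padic)
  then show ?thesis
    using metric_LIMSEQ_D[OF padic_rat_LIMSEQ[of X] assms] that by (metis dist_commute order_refl)
qed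

instance padic :: (prime_card) complete_space
proof
  fix x :: "nat \<Rightarrow> 'a padic" assume x: "Cauchy x"
  have "\<exists>r. dist (x n) (of_rat r) < inverse (real (Suc n))" for n
    by (rule padic_rat_dense[of "inverse (real (Suc n))" "x n"]) auto
  then obtain q where q: "dist (x n) (of_rat (q n)) < inverse (real (Suc n))" for n by metis
  have d0: "(\<lambda>n. dist (x n) (of_rat (q n))) \<longlonglongrightarrow> 0"
    by (rule tendsto_sandwich[OF _ _ tendsto_const LIMSEQ_inverse_real_of_nat])
       (auto intro!: always_eventually less_imp_le[OF q] simp del: of_nat_Suc)
  have "padic_cauchy CARD('a) q"
    unfolding padic_cauchy_def
  proof (intro allI impI)
    fix e :: real assume e: "e > 0"
    then have "e / 3 > 0" by simp
    from metric_LIMSEQ_D[OF d0 this] obtain N where N: "\<forall>n\<ge>N. dist (x n) (of_rat (q n)) < e / 3"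
      by auto
    obtain M where M: "\<forall>m\<ge>M. \<forall>n\<ge>M. dist (x m) (x n) < e / 3"
      using metric_CauchyD[OF x \<open>e / 3 > 0\<close>] by blast
    have "padic_abs CARD('a) (q m - q n) < e" if "m \<ge> max M N" "n \<ge> max M N" for m n
    proof -
      have "padic_abs CARD('a) (q m - q n) = dist (of_rat (q m)) (of_rat (q n) :: 'a padic)"
        unfolding dist_padic_def of_rat_diff[symmetric] padic_norm_of_rat ..
      also have "\<dots> \<le> dist (x m) (of_rat (q m)) + dist (x m) (x n) + dist (x n) (of_rat (q n))"
        using dist_triangle[of "of_rat (q m)" "of_rat (q n)" "x m"]
          dist_triangle[of "x m" "of_rat (q n)" "x n"] by (simp add: dist_commute)
      also have "\<dots> < e / 3 + e / 3 + e / 3"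
        using M N that by (intro add_strict_mono) auto
      finally show ?thesis by simp
    qed
    then show "\<exists>M. \<forall>m\<ge>M. \<forall>n\<ge>M. padic_abs CARD('a) (q m - q n) < e" by blast
  qed
  then have "Rep_padic_seq (Abs_padic_seq q :: 'a padic_seq) = q" by (simp add: Abs_padic_seq_inverse)
  then have "(\<lambda>n. of_rat (q n)) \<longlonglongrightarrow> Padic (Abs_padic_seq q :: 'a padic_seq)"
    using padic_rat_LIMSEQ[of "Abs_padic_seq q :: 'a padic_seq"] by (simp only:)
  then have d1: "(\<lambda>n. dist (of_rat (q n)) (Padic (Abs_padic_seq q) :: 'a padic)) \<longlonglongrightarrow> 0"
    by (rule tendsto_dist_iff[THEN iffD1])
  have "(\<lambda>n. dist (x n) (Padic (Abs_padic_seq q))) \<longlonglongrightarrow> 0"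
    by (rule tendsto_sandwich[OF _ _ tendsto_const tendsto_add_zero[OF d0 d1]])
       (simp_all add: dist_triangle)
  then have "x \<longlonglongrightarrow> Padic (Abs_padic_seq q)" by (rule tendsto_dist_iff[THEN iffD2])
  then show "convergent x" by (auto simp: convergent_def)
qed


section \<open>$p$-adic integers, residues and powers\<close>

definition padic_ints :: "'p::prime_card padic set" where
  "padic_ints = {x. padic_norm x \<le> 1}"

definition padic_units :: "'p::prime_card padic set" where
  "padic_units = {x \<in> padic_ints. \<exists>y\<in>padic_ints. x * y = 1}"

definition padic_cong :: "nat \<Rightarrow> 'p::prime_card padic \<Rightarrow> 'p padic \<Rightarrow> bool" where
  "padic_cong m x y \<longleftrightarrow> (\<exists>u\<in>padic_ints. x - y = of_nat m * u)"

definition padic_residue :: "'p::prime_card padic \<Rightarrow> int" where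
  "padic_residue x = (THE i. i \<in> {0..<int CARD('p)} \<and> padic_cong CARD('p) x (of_int i))"

lemma padic_norm_of_rat_of_int: "padic_norm (of_int a :: 'p::prime_card padic) = padic_abs CARD('p) (of_int a)"
  using padic_norm_of_rat[of "of_int a", where 'p = 'p] by simp

lemma padic_abs_of_int_le_iff:
  assumes p: "prime p"
  shows "padic_abs p (of_int a) \<le> inverse (real p ^ N) \<longleftrightarrow> int p ^ N dvd a"
proof (cases "a = 0")
  case False
  have p1: "real p > 1" using prime_gt_1_nat[OF p] by simp
  have "padic_abs p (of_int a) = real p powi (- int (multiplicity (int p) a))"
    using padic_abs_of_int_divide[OF p False, of 1] by simp
  moreover have "inverse (real p ^ N) = real p powi (- int N)"
    by (simp add: power_int_minus)
  ultimately have "padic_abs p (of_int a) \<le> inverse (real p ^ N) \<longleftrightarrow> N \<le> multiplicity (int p) a"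
    using power_int_strict_increasing[of "- int N" "- int (multiplicity (int p) a)" "real p"]
      power_int_increasing[of "- int (multiplicity (int p) a)" "- int N" "real p"] p1
    by (cases "N \<le> multiplicity (int p) a") auto
  also have "\<dots> \<longleftrightarrow> int p ^ N dvd a"
    using False p by (intro power_dvd_iff_le_multiplicity[symmetric]) auto
  finally show ?thesis .
qed simp

lemma padic_norm_of_int_le_iff:
  "padic_norm (of_int a :: 'p::prime_card padic) \<le> inverse (real CARD('p) ^ N) \<longleftrightarrow> int CARD('p) ^ N dvd a"
  by (simp add: padic_norm_of_rat_of_int padic_abs_of_int_le_iff CARD_prime)

lemma of_int_in_padic_ints [simp]: "of_int a \<in> (padic_ints :: 'p::prime_card padic set)"
  using padic_norm_of_int_le_iff[of a 0, where 'p = 'p] by (simp add: padic_ints_def)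

lemma padic_norm_CARD: "padic_norm (of_nat CARD('p) :: 'p::prime_card padic) = inverse (real CARD('p))"
proof -
  have "prime_elem (int CARD('p))" using CARD_prime[where 'p = 'p] by simp
  then have "padic_abs CARD('p) (of_int (int CARD('p))) = inverse (real CARD('p))"
    using padic_abs_of_int_divide[OF CARD_prime[where 'p = 'p], of "int CARD('p)" 1]
      prime_gt_0_nat[OF CARD_prime[where 'p = 'p]]
    by (simp add: power_int_minus)
  then show ?thesis using padic_norm_of_rat_of_int[of "int CARD('p)", where 'p = 'p] by simp
qed

lemma padic_norm_1 [simp]: "padic_norm (1 :: 'p::prime_card padic) = 1"
  using padic_norm_of_rat[of 1, where 'p = 'p] by simp

lemma padic_norm_0 [simp]: "padic_norm (0 :: 'p::prime_card padic) = 0"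
  by simp

lemma padic_norm_power: "padic_norm (x ^ n :: 'p::prime_card padic) = padic_norm x ^ n"
  by (induction n) (simp_all add: padic_norm_mult)

lemma padic_cong_iff_norm:
  fixes x y :: "'p::prime_card padic"
  shows "padic_cong (CARD('p) ^ N) x y \<longleftrightarrow> padic_norm (x - y) \<le> inverse (real CARD('p) ^ N)"
proof
  assume "padic_cong (CARD('p) ^ N) x y"
  then obtain u where "padic_norm u \<le> 1" "x - y = of_nat CARD('p) ^ N * u"
    by (auto simp: padic_cong_def padic_ints_def)
  then show "padic_norm (x - y) \<le> inverse (real CARD('p) ^ N)"
    by (simp add: padic_norm_mult padic_norm_power padic_norm_CARD power_inverse mult_left_le)
next
  assume *: "padic_norm (x - y) \<le> inverse (real CARD('p) ^ N)"
  define u where "u = (x - y) / of_nat CARD('p) ^ N"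
  have u: "x - y = of_nat CARD('p) ^ N * u"
    using prime_gt_0_nat[OF CARD_prime[where 'p = 'p]] by (simp add: u_def)
  with * have "inverse (real CARD('p) ^ N) * padic_norm u \<le> inverse (real CARD('p) ^ N) * 1"
    by (simp add: padic_norm_mult padic_norm_power padic_norm_CARD power_inverse)
  then have "padic_norm u \<le> 1"
    by (rule mult_left_le_imp_le) (simp add: prime_gt_0_nat[OF CARD_prime])
  with u show "padic_cong (CARD('p) ^ N) x y"
    by (auto simp: padic_cong_def padic_ints_def)
qed

lemma padic_int_approx:
  fixes x :: "'p::prime_card padic"
  assumes x: "x \<in> padic_ints"
  obtains i where "i \<in> {0..<int CARD('p) ^ N}" "padic_cong (CARD('p) ^ N) x (of_int i)"
proof -
  let ?p = "CARD('p)"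
  have p: "prime ?p" by (rule CARD_prime)
  have p1: "real ?p > 1" using prime_gt_1_nat[OF p] by simp
  obtain r where r: "dist x (of_rat r) < inverse (real ?p ^ N)"
    by (rule padic_rat_dense[of "inverse (real ?p ^ N)" x]) (use p1 in auto)
  have le1: "inverse (real ?p ^ N) \<le> 1" using p1 by (intro inverse_le_1_iff[THEN iffD2]) auto
  have "padic_norm (of_rat r :: 'p padic) \<le> max (padic_norm x) (padic_norm (of_rat r - x))"
    using padic_norm_add_le_max[of x "of_rat r - x"] by simp
  also have "\<dots> \<le> 1"
    using x r le1 padic_norm_minus[of "x - of_rat r"] by (simp add: padic_ints_def dist_padic_def)
  finally have r1: "padic_abs ?p r \<le> 1" by (simp add: padic_norm_of_rat)
  obtain c d where cd: "quotient_of r = (c, d)" by (cases "quotient_of r")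
  have d: "d > 0" using quotient_of_denom_pos[OF cd] .
  have rcd: "r = of_int c / of_int d" using quotient_of_div[OF cd] .
  have cop: "coprime c d" using quotient_of_coprime[OF cd] .
  have "\<not> int ?p dvd d"
  proof
    assume pd: "int ?p dvd d"
    with cop p have pc: "\<not> int ?p dvd c"
      by (meson coprime_common_divisor not_prime_unit prime_nat_int_transfer)
    then have c0: "c \<noteq> 0" by auto
    have "multiplicity (int ?p) d \<ge> 1" using pd d p by (intro multiplicity_geI) auto
    moreover have "multiplicity (int ?p) c = 0" using pc by (rule not_dvd_imp_multiplicity_0)
    ultimately have "padic_abs ?p r = real ?p ^ multiplicity (int ?p) d"
        and "real ?p ^ 1 \<le> real ?p ^ multiplicity (int ?p) d"
      using padic_abs_of_int_divide[OF p c0, of d] d p1 rcd by (simp, intro power_increasing) auto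
    then show False using r1 p1 unfolding power_one_right by linarith
  qed
  then have "coprime (int ?p) d" using p by (simp add: prime_imp_coprime)
  then have "coprime d (int ?p ^ N)" by (simp add: coprime_commute)
  then obtain e where e: "[d * e = 1] (mod int ?p ^ N)" using cong_solve_coprime_int by blast
  define i where "i = (c * e) mod int ?p ^ N"
  have i: "i \<in> {0..<int ?p ^ N}" using p1 by (simp add: i_def)
  have "[i * d = c * (d * e)] (mod int ?p ^ N)"
    unfolding i_def cong_def mod_mult_left_eq by (simp add: ac_simps)
  also have "[c * (d * e) = c * 1] (mod int ?p ^ N)" using e by (intro cong_mult cong_refl)
  finally have dvd: "int ?p ^ N dvd c - i * d" by (simp add: cong_iff_dvd_diff dvd_diff_commute)
  have "padic_abs ?p (of_int d) = 1"
    using padic_abs_of_int_divide[OF p, of d 1] d not_dvd_imp_multiplicity_0[OF \<open>\<not> int ?p dvd d\<close>] by simp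
  moreover have "(r - of_int i) * of_int d = of_int (c - i * d)"
    using d by (simp add: rcd field_simps)
  ultimately have "padic_abs ?p (r - of_int i) = padic_abs ?p (of_int (c - i * d))"
    using padic_abs_mult[OF p, of "r - of_int i" "of_int d"] by simp
  also have "\<dots> \<le> inverse (real ?p ^ N)" using dvd padic_abs_of_int_le_iff[OF p] by blast
  finally have "padic_norm (of_rat r - of_int i :: 'p padic) \<le> inverse (real ?p ^ N)"
    using padic_norm_of_rat[of "r - of_int i", where 'p = 'p] by (simp add: of_rat_diff)
  then have "padic_norm (x - of_int i) \<le> inverse (real ?p ^ N)"
    using padic_norm_add_le_max[of "x - of_rat r" "of_rat r - of_int i"] r
    by (simp add: dist_padic_def)
  then show ?thesis using i that by (simp add: padic_cong_iff_norm)
qed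

lemma padic_residue_ex1:
  fixes x :: "'p::prime_card padic"
  assumes x: "x \<in> padic_ints"
  shows "\<exists>!i. i \<in> {0..<int CARD('p)} \<and> padic_cong CARD('p) x (of_int i)"
proof -
  obtain i where i: "i \<in> {0..<int CARD('p)}" "padic_cong CARD('p) x (of_int i)"
    using padic_int_approx[OF x, of 1] by auto
  have "j = i" if j: "j \<in> {0..<int CARD('p)}" "padic_cong CARD('p) x (of_int j)" for j
  proof -
    have "padic_norm (of_int (j - i) :: 'p padic) \<le> inverse (real CARD('p) ^ 1)"
      using i(2) j(2) padic_cong_iff_norm[of 1 x "of_int i"] padic_cong_iff_norm[of 1 x "of_int j"]
        padic_norm_add_le_max[of "x - of_int i" "- (x - of_int j)"] padic_norm_minus[of "x - of_int j"]
      by simp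
    then have "int CARD('p) dvd j - i" using padic_norm_of_int_le_iff[of "j - i" 1, where 'p = 'p] by simp
    then show ?thesis using i(1) j(1) by (simp add: mod_eq_dvd_iff[symmetric])
  qed
  with i show ?thesis by blast
qed

lemma padic_norm_gchoose_le_1:
  fixes s :: "'p::prime_card padic"
  assumes s: "s \<in> padic_ints"
  shows "padic_norm (s gchoose k) \<le> 1"
proof -
  define P where "P x k = (\<Prod>i=0..<k. x - of_nat i)" for x :: "'p padic" and k
  have mem: "padic_norm (x - of_nat k) \<le> 1" if "x \<in> padic_ints" for x :: "'p padic" and k
    using that padic_norm_add_le_max[of x "- of_nat k"] of_int_in_padic_ints[of "int k", where 'p = 'p]
    by (simp add: padic_ints_def)
  have P1: "padic_norm (P x k) \<le> 1" if "x \<in> padic_ints" for x k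
    using mem[OF that] by (induction k) (auto simp: P_def padic_norm_mult intro!: mult_le_one)
  have lip: "padic_norm (P x k - P y k) \<le> padic_norm (x - y)"
    if x: "x \<in> padic_ints" and y: "y \<in> padic_ints" for x y k
  proof (induction k)
    case (Suc k)
    have "P x (Suc k) - P y (Suc k) = P x k * (x - y) + (P x k - P y k) * (y - of_nat k)"
      by (simp add: P_def algebra_simps)
    moreover have "padic_norm (P x k * (x - y)) \<le> padic_norm (x - y)"
      using P1[OF x, of k] by (simp add: padic_norm_mult mult_left_le_one_le)
    moreover have "padic_norm ((P x k - P y k) * (y - of_nat k)) \<le> padic_norm (x - y) * 1"
      unfolding padic_norm_mult using Suc mem[OF y] by (intro mult_mono) auto
    ultimately show ?case
      using padic_norm_add_le_max[of "P x k * (x - y)" "(P x k - P y k) * (y - of_nat k)"] by simp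
  qed (simp add: P_def)
  have fact: "(x gchoose k) * fact k = P x k" for x by (simp add: gbinomial_prod_rev P_def)
  let ?f = "padic_norm (fact k :: 'p padic)"
  have f: "?f > 0" using padic_norm_nonneg[of "fact k :: 'p padic"] by (simp add: less_le del: padic_norm_nonneg)
  have "(\<lambda>N. inverse (real CARD('p)) ^ N) \<longlonglongrightarrow> 0"
    using prime_gt_1_nat[OF CARD_prime[where 'p = 'p]] by (intro LIMSEQ_power_zero) (auto simp: inverse_less_1_iff)
  then obtain N where N: "inverse (real CARD('p)) ^ N < ?f"
    using order_tendstoD(2)[OF _ f] by (metis eventually_sequentially order_refl)
  obtain i where i: "i \<in> {0..<int CARD('p) ^ N}" "padic_cong (CARD('p) ^ N) s (of_int i)"
    by (rule padic_int_approx[OF s])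
  define n where "n = nat i"
  have n: "of_int i = (of_nat n :: 'p padic)" using i by (simp add: n_def)
  have "padic_norm (P s k - P (of_nat n) k) \<le> padic_norm (s - of_nat n)"
    using lip[OF s of_int_in_padic_ints[of i]] n by metis
  also have "\<dots> \<le> ?f" using i N n by (simp add: padic_cong_iff_norm power_inverse)
  finally have 1: "padic_norm (P s k - P (of_nat n) k) \<le> ?f" .
  have "P (of_nat n) k = of_int (int (n choose k)) * fact k"
    using fact[of "of_nat n"] by (simp add: binomial_gbinomial)
  then have "padic_norm (P (of_nat n) k) \<le> 1 * ?f"
    using of_int_in_padic_ints[of "int (n choose k)", where 'p = 'p]
    by (simp only: padic_norm_mult) (intro mult_right_mono, auto simp: padic_ints_def)
  with 1 have "padic_norm (P s k) \<le> ?f"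
    using padic_norm_add_le_max[of "P s k - P (of_nat n) k" "P (of_nat n) k"] by simp
  then show ?thesis
    unfolding fact[symmetric] padic_norm_mult using f by (simp add: mult_le_cancel_right1)
qed

lemma padic_unit_norm: "w \<in> padic_units \<Longrightarrow> padic_norm w = 1"
proof -
  assume "w \<in> padic_units"
  then obtain y where le: "padic_norm w \<le> 1" "padic_norm y \<le> 1" and wy: "w * y = 1"
    by (auto simp: padic_units_def padic_ints_def)
  have "1 = padic_norm w * padic_norm y" using wy padic_norm_mult[of w y] by simp
  also have "\<dots> \<le> padic_norm w" using le by (intro mult_left_le) auto
  finally show ?thesis using le by simp
qed

lemma padic_fermat:
  fixes w :: "'p::prime_card padic"
  assumes w: "w \<in> padic_units"
  shows "padic_cong CARD('p) (w ^ (CARD('p) - 1)) 1"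
proof -
  let ?p = "CARD('p)"
  have wi: "w \<in> padic_ints" using w by (simp add: padic_units_def)
  obtain i where i: "i \<in> {0..<int ?p}" "padic_cong ?p w (of_int i)"
    using padic_residue_ex1[OF wi] by blast
  have p1: "real ?p > 1" using prime_gt_1_nat[OF CARD_prime[where 'p = 'p]] by simp
  have n1: "padic_norm (w - of_int i) \<le> inverse (real ?p)"
    using i(2) padic_cong_iff_norm[of 1 w "of_int i"] by simp
  have "\<not> int ?p dvd i"
  proof
    assume "int ?p dvd i"
    then have "padic_norm (of_int i :: 'p padic) \<le> inverse (real ?p)"
      using padic_norm_of_int_le_iff[of i 1, where 'p = 'p] by simp
    then have "padic_norm w \<le> inverse (real ?p)"
      using n1 padic_norm_add_le_max[of "w - of_int i" "of_int i"] by simp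
    then show False using padic_unit_norm[OF w] p1 by (simp add: inverse_eq_divide)
  qed
  then have "i \<noteq> 0" by auto
  define n where "n = nat i"
  have n: "i = int n" using i by (simp add: n_def)
  have "[n ^ (?p - 1) = 1] (mod ?p)"
    using \<open>\<not> int ?p dvd i\<close> n by (intro fermat_theorem CARD_prime) auto
  then have "int ?p dvd i ^ (?p - 1) - 1"
    unfolding n by (metis cong_iff_dvd_diff cong_int_iff of_nat_1 of_nat_power)
  then have 1: "padic_norm (of_int (i ^ (?p - 1) - 1) :: 'p padic) \<le> inverse (real ?p)"
    using padic_norm_of_int_le_iff[of "i ^ (?p - 1) - 1" 1, where 'p = 'p] by simp
  have pw: "padic_norm (w ^ m - of_int i ^ m) \<le> inverse (real ?p)" for m
  proof (induction m)
    case (Suc m)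
    have "w ^ Suc m - of_int i ^ Suc m = w * (w ^ m - of_int i ^ m) + (w - of_int i) * of_int i ^ m"
      by (simp add: algebra_simps)
    moreover have "padic_norm (w * (w ^ m - of_int i ^ m)) \<le> inverse (real ?p)"
      using Suc by (simp add: padic_norm_mult padic_unit_norm[OF w])
    moreover have "padic_norm ((w - of_int i) * of_int i ^ m) \<le> inverse (real ?p) * 1"
      unfolding padic_norm_mult using n1 of_int_in_padic_ints[of "i ^ m", where 'p = 'p]
      by (intro mult_mono) (auto simp: padic_ints_def)
    ultimately show ?case
      using padic_norm_add_le_max[of "w * (w ^ m - of_int i ^ m)" "(w - of_int i) * of_int i ^ m"]
      by simp
  qed simp
  have "padic_norm (w ^ (?p - 1) - 1) \<le> inverse (real ?p)"
    using 1 pw[of "?p - 1"]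
      padic_norm_add_le_max[of "w ^ (?p - 1) - of_int i ^ (?p - 1)" "of_int i ^ (?p - 1) - 1"]
    by simp
  then show ?thesis using padic_cong_iff_norm[of 1 "w ^ (?p - 1)" 1] by simp
qed

text \<open>
  A pair \<open>(a, s)\<close> of an integer and a $p$-adic integer stands for the formal exponent
  $a + s(p-1)$. The value of this sum in the $p$-adic integers does not determine the power:
  $0 + \frac{1}{p-1}(p-1)$ and $1 + 0(p-1)$ are equal there, but give different powers.
  Exponents are added and subtracted componentwise.
\<close>

type_synonym 'p padic_exponent = "int \<times> 'p padic"

definition padic_power :: "'p::prime_card padic \<Rightarrow> 'p padic_exponent \<Rightarrow> 'p padic" where
  "padic_power w e = w powi fst e * (\<Sum>k. (snd e gchoose k) * (w ^ (CARD('p) - 1) - 1) ^ k)"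

lemma padic_power_summable:
  fixes w s :: "'p::prime_card padic"
  assumes w: "w \<in> padic_units" and s: "s \<in> padic_ints"
  shows "summable (\<lambda>k. (s gchoose k) * (w ^ (CARD('p) - 1) - 1) ^ k)"
proof -
  let ?q = "inverse (real CARD('p))"
  define f where "f k = (s gchoose k) * (w ^ (CARD('p) - 1) - 1) ^ k" for k
  have q: "0 \<le> ?q" "?q < 1"
    using prime_gt_1_nat[OF CARD_prime[where 'p = 'p]] by (auto simp: inverse_less_1_iff)
  have t: "padic_norm (w ^ (CARD('p) - 1) - 1) \<le> ?q"
    using padic_fermat[OF w] padic_cong_iff_norm[of 1 "w ^ (CARD('p) - 1)" 1] by simp
  have f: "padic_norm (f k) \<le> ?q ^ k" for k
  proof -
    have "padic_norm (f k) \<le> 1 * ?q ^ k"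
      unfolding f_def padic_norm_mult padic_norm_power
      by (intro mult_mono power_mono t padic_norm_gchoose_le_1 s) auto
    then show ?thesis by simp
  qed
  have tail: "padic_norm (sum f {..<m + d} - sum f {..<m}) \<le> ?q ^ m" for m d
  proof (induction d)
    case (Suc d)
    have "?q ^ (m + d) \<le> ?q ^ m" using q by (intro power_decreasing) auto
    then show ?case
      using Suc f[of "m + d"] padic_norm_add_le_max[of "sum f {..<m + d} - sum f {..<m}" "f (m + d)"]
      by (simp add: algebra_simps)
  qed simp
  have "Cauchy (\<lambda>n. sum f {..<n})"
  proof (rule metric_CauchyI)
    fix e :: real assume "e > 0"
    moreover have "(\<lambda>N. ?q ^ N) \<longlonglongrightarrow> 0" using q by (intro LIMSEQ_power_zero) auto
    ultimately obtain M where M: "?q ^ M < e"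
      using order_tendstoD(2) by (metis eventually_sequentially order_refl)
    have "dist (sum f {..<m}) (sum f {..<n}) < e" if "m \<ge> M" "n \<ge> M" for m n
    proof -
      have *: "dist (sum f {..<m + d}) (sum f {..<m}) < e" if "m \<ge> M" for m d
      proof -
        have "?q ^ m \<le> ?q ^ M" using q that by (intro power_decreasing) auto
        then show ?thesis using tail[of m d] M by (simp add: dist_padic_def)
      qed
      show ?thesis
        using *[of m "n - m"] *[of n "m - n"] that by (cases "m \<le> n") (simp_all add: dist_commute)
    qed
    then show "\<exists>M. \<forall>m\<ge>M. \<forall>n\<ge>M. dist (sum f {..<m}) (sum f {..<n}) < e" by blast
  qed
  then show ?thesis unfolding f_def[symmetric]
    by (simp add: summable_iff_convergent Cauchy_convergent)
qed

definition padic_lambda :: "'p::prime_card padic \<Rightarrow> 'p padic_exponent" where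
  "padic_lambda \<alpha> = (- padic_residue (- \<alpha>), (\<alpha> + of_int (padic_residue (- \<alpha>))) / of_nat CARD('p))"

definition hyp2F1_trunc :: "'a::field_char_0 \<Rightarrow> 'a \<Rightarrow> 'a \<Rightarrow> 'a \<Rightarrow> nat \<Rightarrow> 'a" where
  "hyp2F1_trunc \<alpha> \<beta> \<gamma> z n =
     (\<Sum>k=0..n. pochhammer \<alpha> k * pochhammer \<beta> k / pochhammer \<gamma> k * (z ^ k / fact k))"

end

theory Submission
  imports Defs "HOL-Computational_Algebra.Formal_Power_Series"
begin

text \<open>
  Write $p = 2m+1$ and $\alpha = pt - a$ with $a$ even, $0 \le a < p$, and let
  $F$, $G$ be the truncated series on the left and on the right.
  The quadratic transformation
  $(1-X)^{\alpha} F(\alpha,\alpha;1;X) = F(\frac{\alpha}{2},\frac{1-\alpha}{2};1;-4X/(1-X)^2)$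
  of formal power series, multiplied by $(1-X)^{2m}$ and cut off below $X^p$, says modulo $p^2$ that
  $Q_n = V_n - pt \sum_{i=1}^{n} V_{n-i}/i$, where $V_n$ and $Q_n$ are the coefficients of the polynomials
  $(1-X)^{2m-a} F(X)$ and $(1-X)^{2m} G$: the sum comes from
  $(1-X)^{pt} \equiv 1 - pt \sum_i X^i/i$.
  The polynomial with coefficients $Q_n$ is palindromic of degree $p-1$.
  Summing the relation against $z^n - z^{p-n}$ turns the left side into $(1-z)^p G$ and the terms $V_n$ into
  $(1-z)^{2m-a}(F(z) - z^{1+a}F(1/z))$; modulo $p$ the remaining sum is, by the palindromic symmetry and
  Fermat's little theorem, the product of the truncated logarithm $\sum_{i<p} z^i/i$ with $\sum_n V_n z^n$.
  As $p \sum_{i<p} z^i/i \equiv -(z^p - z) - ((1-z)^p - (1-z))$ modulo $p^2$, this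
  product accounts exactly for the first order terms of the powers $z^{1-\lambda}$ and $(1-z)^{1-\lambda}$.
\<close>

subsection \<open>The quadratic transformation\<close>

text \<open>The coefficient of y^k in F(\<alpha>/2, (1-\<alpha>)/2; 1; -4y). Absorbing (-4)^k leaves
  the argument y = X/(1-X)^2, whose powers expand in X without further constants.\<close>

definition quad_coeff :: "'a::field_char_0 \<Rightarrow> nat \<Rightarrow> 'a" where
  "quad_coeff \<alpha> k = (-4) ^ k * (pochhammer (\<alpha> / 2) k * pochhammer ((1 - \<alpha>) / 2) k) / (fact k)\<^sup>2"

lemma quad_coeff_Suc:
  "(of_nat (Suc k))\<^sup>2 * quad_coeff \<alpha> (Suc k)
    = - ((\<alpha> + 2 * of_nat k) * (1 - \<alpha> + 2 * of_nat k)) * quad_coeff \<alpha> k"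
proof -
  have "of_nat (Suc k) \<noteq> (0::'a)" "fact k \<noteq> (0::'a)" by (simp_all del: of_nat_Suc)
  then show ?thesis
    by (simp add: quad_coeff_def pochhammer_Suc field_simps power2_eq_square del: of_nat_Suc)
qed

text \<open>The coefficient of $X^n$ in $(1-X)^c$.\<close>

definition bincoeff :: "'a::field_char_0 \<Rightarrow> nat \<Rightarrow> 'a" where
  "bincoeff c n = pochhammer (- c) n / fact n"

context
  fixes \<alpha> :: "'a::field_char_0"
begin

text \<open>The share of y^k in the coefficient of X^n, because y^k (1-X)^(-\<alpha>) = X^k
  (1-X)^(-\<alpha>-2k). For \<open>k > n\<close> truncated subtraction yields
  \<open>quad_coeff \<alpha> k\<close> instead of 0, so the range of \<open>k\<close> has to be
  watched.\<close>

definition quad_term :: "nat \<Rightarrow> nat \<Rightarrow> 'a" where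
  "quad_term n k = quad_coeff \<alpha> k * bincoeff (- \<alpha> - 2 * of_nat k) (n - k)"

lemma quad_term_Suc:
  assumes "k \<le> n"
  shows "of_nat (Suc n - k) * quad_term (Suc n) k = (\<alpha> + of_nat (n + k)) * quad_term n k"
proof -
  have "Suc n - k = Suc (n - k)" using assms by simp
  moreover have "of_nat (Suc (n - k)) \<noteq> (0::'a)" by (simp del: of_nat_Suc)
  ultimately show ?thesis using assms
    by (simp add: quad_term_def bincoeff_def pochhammer_Suc of_nat_diff divide_simps del: of_nat_Suc)
qed

text \<open>With x = \<alpha>+2k and n = k+d+1, the terms for k and k+1 contain the rising
  factorials of x with d+1 factors and of x+2 with d factors. Both sit inside the one of x with d+2
  factors: drop its last factor, or its first two.\<close>

lemma quad_term_right:
  assumes "k < n"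
  shows "(1 - \<alpha> + 2 * of_nat k) * (\<alpha> + of_nat (n + k)) * (of_nat (n - k) * quad_term n k)
    = - ((of_nat (Suc k))\<^sup>2 * (\<alpha> + 2 * of_nat k + 1)) * quad_term n (Suc k)"
proof -
  obtain d where n: "n = Suc (k + d)" using assms less_iff_Suc_add by auto
  have nz: "of_nat (Suc d) \<noteq> (0::'a)" "fact d \<noteq> (0::'a)" by (simp_all del: of_nat_Suc)
  let ?x = "\<alpha> + 2 * of_nat k"
  have "pochhammer ?x (Suc (Suc d)) = ?x * ((?x + 1) * pochhammer (?x + 1 + 1) d)"
    by (simp only: pochhammer_rec)
  moreover have "pochhammer ?x (Suc (Suc d)) = pochhammer ?x (Suc d) * (\<alpha> + of_nat (n + k))"
    unfolding n by (simp add: pochhammer_Suc algebra_simps)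
  ultimately have P: "pochhammer ?x (Suc d) * (\<alpha> + of_nat (n + k))
      = ?x * ((?x + 1) * pochhammer (?x + 2) d)" by (simp add: add.assoc)
  have l: "of_nat (n - k) * quad_term n k = quad_coeff \<alpha> k * pochhammer ?x (Suc d) / fact d"
    using nz unfolding n by (simp add: quad_term_def bincoeff_def Suc_diff_le field_simps del: of_nat_Suc)
  have r: "quad_term n (Suc k) = quad_coeff \<alpha> (Suc k) * pochhammer (?x + 2) d / fact d"
    unfolding n by (simp add: quad_term_def bincoeff_def algebra_simps)
  have "(1 - \<alpha> + 2 * of_nat k) * (\<alpha> + of_nat (n + k)) * (of_nat (n - k) * quad_term n k)
    = (1 - \<alpha> + 2 * of_nat k) * quad_coeff \<alpha> k * (pochhammer ?x (Suc d) * (\<alpha> + of_nat (n + k))) / fact d"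
    unfolding l by simp
  also have "\<dots> = (?x * (1 - \<alpha> + 2 * of_nat k) * quad_coeff \<alpha> k) * ((?x + 1) * pochhammer (?x + 2) d) / fact d"
    unfolding P by simp
  also have "?x * (1 - \<alpha> + 2 * of_nat k) * quad_coeff \<alpha> k = - ((of_nat (Suc k))\<^sup>2 * quad_coeff \<alpha> (Suc k))"
    unfolding quad_coeff_Suc by simp
  finally show ?thesis unfolding r by simp
qed

text \<open>The telescoping form of the recurrence comes from Zeilberger's algorithm.\<close>

lemma quad_term_partial_sum:
  assumes "j \<le> n"
  shows "(\<Sum>k\<le>j. (of_nat (Suc n))\<^sup>2 * quad_term (Suc n) k - (\<alpha> + of_nat n)\<^sup>2 * quad_term n k)
    = (1 - \<alpha> + 2 * of_nat j) * (\<alpha> + of_nat (n + j)) * quad_term n j"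
  using assms
proof (induction j)
  case 0
  have "of_nat (Suc n) * (of_nat (Suc n) * quad_term (Suc n) 0)
      = of_nat (Suc n) * ((\<alpha> + of_nat n) * quad_term n 0)"
    using quad_term_Suc[of 0 n] by simp
  then show ?case by (simp add: power2_eq_square algebra_simps)
next
  case (Suc j)
  \<comment> \<open>Multiplication by the nonzero s = n-j makes both ratio identities applicable:
    \<open>1\<close> and \<open>2\<close> turn every term into a multiple of \<open>?T\<close>,
    which leaves a polynomial identity.\<close>
  define s where "s = (of_nat (n - j) :: 'a)"
  have nz: "s \<noteq> 0" using Suc.prems by (simp add: s_def)
  have n: "of_nat n = of_nat j + s" using Suc.prems by (simp add: s_def of_nat_diff)
  let ?T = "quad_term n (Suc j)"
  have 1: "s * quad_term (Suc n) (Suc j) = (\<alpha> + of_nat n + of_nat j + 1) * ?T"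
    using quad_term_Suc[of "Suc j" n] Suc.prems by (simp add: s_def algebra_simps)
  have 2: "s * ((1 - \<alpha> + 2 * of_nat j) * (\<alpha> + of_nat (n + j)) * quad_term n j)
      = - ((of_nat j + 1)\<^sup>2 * (\<alpha> + 2 * of_nat j + 1)) * ?T"
    using quad_term_right[of j n] Suc.prems by (simp add: s_def algebra_simps)
  have expand: "s * (A + (B * c - d * e)) = s * A + B * (s * c) - s * d * e" for A B c d e
    by (simp add: algebra_simps)
  have "s * (\<Sum>k\<le>Suc j. (of_nat (Suc n))\<^sup>2 * quad_term (Suc n) k - (\<alpha> + of_nat n)\<^sup>2 * quad_term n k)
    = s * ((1 - \<alpha> + 2 * of_nat j) * (\<alpha> + of_nat (n + j)) * quad_term n j)
      + (of_nat (Suc n))\<^sup>2 * (s * quad_term (Suc n) (Suc j)) - s * (\<alpha> + of_nat n)\<^sup>2 * ?T"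
    unfolding sum.atMost_Suc Suc.IH[OF Suc_leD[OF Suc.prems]] by (rule expand)
  also have "\<dots> = s * ((1 - \<alpha> + 2 * of_nat (Suc j)) * (\<alpha> + of_nat (n + Suc j)) * ?T)"
    unfolding 1 2 unfolding of_nat_add of_nat_Suc n by (simp add: power2_eq_square algebra_simps)
  finally show ?case using nz by simp
qed

text \<open>
  Comparison of the coefficients of $X^n$ in
  $(1-X)^{-\alpha} F(\frac{\alpha}{2},\frac{1-\alpha}{2};1;-4X/(1-X)^2) = F(\alpha,\alpha;1;X)$.
\<close>

lemma quadratic_transformation_coeff:
  "(\<Sum>k\<le>n. quad_coeff \<alpha> k * bincoeff (- \<alpha> - 2 * of_nat k) (n - k)) = (pochhammer \<alpha> n / fact n)\<^sup>2"
proof (induction n)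
  case 0
  show ?case by (simp add: quad_coeff_def bincoeff_def)
next
  case (Suc n)
  let ?N = "of_nat (Suc n) :: 'a"
  have nz: "?N \<noteq> 0" by (simp del: of_nat_Suc)
  have d: "quad_term k k = quad_coeff \<alpha> k" for k by (simp add: quad_term_def bincoeff_def)
  \<comment> \<open>The telescoped sum at j = n cancels against the boundary term k = n+1 by
    \<open>quad_coeff_Suc\<close>. What remains is the first order recurrence satisfied by the right
    side.\<close>
  have "?N\<^sup>2 * (\<Sum>k\<le>n. quad_term (Suc n) k) - (\<alpha> + of_nat n)\<^sup>2 * (\<Sum>k\<le>n. quad_term n k)
      + ?N\<^sup>2 * quad_term (Suc n) (Suc n) = 0"
  proof -
    have "?N\<^sup>2 * (\<Sum>k\<le>n. quad_term (Suc n) k) - (\<alpha> + of_nat n)\<^sup>2 * (\<Sum>k\<le>n. quad_term n k)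
        = (1 - \<alpha> + 2 * of_nat n) * (\<alpha> + of_nat (n + n)) * quad_coeff \<alpha> n"
      using quad_term_partial_sum[of n n] unfolding d
      by (simp add: sum_subtractf sum_distrib_left del: of_nat_Suc)
    then show ?thesis unfolding d quad_coeff_Suc by (simp add: algebra_simps)
  qed
  then have "?N\<^sup>2 * (\<Sum>k\<le>Suc n. quad_term (Suc n) k) = (\<alpha> + of_nat n)\<^sup>2 * (\<Sum>k\<le>n. quad_term n k)"
    by (simp add: algebra_simps del: of_nat_Suc)
  also have "(\<Sum>k\<le>n. quad_term n k) = (pochhammer \<alpha> n / fact n)\<^sup>2"
    using Suc by (simp add: quad_term_def)
  also have "(\<alpha> + of_nat n)\<^sup>2 * (pochhammer \<alpha> n / fact n)\<^sup>2 = ?N\<^sup>2 * (pochhammer \<alpha> (Suc n) / fact (Suc n))\<^sup>2"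
    using nz by (simp add: pochhammer_Suc field_simps power2_eq_square del: of_nat_Suc)
  finally show ?case using nz by (simp add: quad_term_def del: of_nat_Suc)
qed

end

section \<open>Products with powers of 1-X\<close>

lemma bincoeff_vandermonde:
  "(\<Sum>i\<le>n. bincoeff c i * bincoeff d (n - i)) = bincoeff (c + d) n"
proof -
  have "bincoeff c i * bincoeff d (n - i)
      = of_nat (n choose i) * pochhammer (- c) i * pochhammer (- d) (n - i) / fact n" if "i \<le> n" for i
    using that by (simp add: bincoeff_def binomial_fact)
  then have "(\<Sum>i\<le>n. bincoeff c i * bincoeff d (n - i))
      = (\<Sum>i\<le>n. of_nat (n choose i) * pochhammer (- c) i * pochhammer (- d) (n - i)) / fact n"
    by (simp add: sum_divide_distrib)
  then show ?thesis
    using pochhammer_binomial_sum[of "- c" "- d" n] by (simp add: bincoeff_def)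
qed

lemma bincoeff_of_nat: "bincoeff (of_nat N) n = (-1) ^ n * of_nat (N choose n)"
  by (simp add: bincoeff_def binomial_gbinomial gbinomial_pochhammer)

lemma power_one_minus_eq_sum:
  "(1 - x :: 'a::field_char_0) ^ N = (\<Sum>i\<le>N. bincoeff (of_nat N) i * x ^ i)"
  using binomial_ring[of "- x" 1 N]
  by (simp add: bincoeff_of_nat power_minus[of x] ac_simps)

lemma sum_triangle_swap:
  fixes h :: "nat \<Rightarrow> nat \<Rightarrow> 'a::comm_monoid_add"
  shows "(\<Sum>i\<le>n. \<Sum>k\<le>n - i. h i k) = (\<Sum>k\<le>n. \<Sum>i\<le>n - k. h i k)"
proof -
  have "{k. k \<le> n \<and> i + k \<le> n} = {..n - i}" "{k. k \<le> n \<and> k + i \<le> n} = {..n - i}" if "i \<le> n" for i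
    using that by auto
  then show ?thesis
    using sum.swap_restrict[of "{..n}" "{..n}" h "\<lambda>i k. i + k \<le> n"] by simp
qed

text \<open>The quadratic transformation multiplied by (1-X)^(\<alpha>+d): each X^k
  (1-X)^(-\<alpha>-2k) becomes X^k (1-X)^(d-2k), a polynomial when d = 2m and k \<le> m.\<close>

lemma bincoeff_convolution:
  fixes \<alpha> d :: "'a::field_char_0"
  shows "(\<Sum>i\<le>n. bincoeff (\<alpha> + d) i * (pochhammer \<alpha> (n - i) / fact (n - i))\<^sup>2)
    = (\<Sum>k\<le>n. quad_coeff \<alpha> k * bincoeff (d - 2 * of_nat k) (n - k))"
proof -
  have "(\<Sum>i\<le>n. bincoeff (\<alpha> + d) i * (pochhammer \<alpha> (n - i) / fact (n - i))\<^sup>2)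
      = (\<Sum>i\<le>n. \<Sum>k\<le>n - i. quad_coeff \<alpha> k *
          (bincoeff (\<alpha> + d) i * bincoeff (- \<alpha> - 2 * of_nat k) (n - k - i)))"
    unfolding quadratic_transformation_coeff[symmetric] sum_distrib_left
    by (simp only: diff_commute mult.left_commute)
  also have "\<dots> = (\<Sum>k\<le>n. quad_coeff \<alpha> k *
      (\<Sum>i\<le>n - k. bincoeff (\<alpha> + d) i * bincoeff (- \<alpha> - 2 * of_nat k) (n - k - i)))"
    by (subst sum_triangle_swap) (simp add: sum_distrib_left)
  also have "\<dots> = (\<Sum>k\<le>n. quad_coeff \<alpha> k * bincoeff (d - 2 * of_nat k) (n - k))"
    unfolding bincoeff_vandermonde by simp
  finally show ?thesis .
qed

subsection \<open>Congruences between $p$-adic integers\<close>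

text \<open>The ideal p^N Z_p, described by the norm so that the ultrametric inequality gives its
  closure rules at once; N = 0 gives the p-adic integers.\<close>

definition padic_ideal :: "nat \<Rightarrow> 'p::prime_card padic set" where
  "padic_ideal N = {x. padic_norm x \<le> inverse (real CARD('p) ^ N)}"

lemma padic_cong_iff_ideal:
  "padic_cong (CARD('p) ^ N) x y \<longleftrightarrow> x - y \<in> (padic_ideal N :: 'p::prime_card padic set)"
  by (simp add: padic_cong_iff_norm padic_ideal_def)

lemma padic_ints_eq_ideal: "padic_ints = padic_ideal 0"
  by (simp add: padic_ints_def padic_ideal_def)

lemma CARD_real_gt_1: "real CARD('p::prime_card) > 1"
  using prime_gt_1_nat[OF CARD_prime[where 'p = 'p]] by simp

lemma padic_ideal_0 [simp]: "0 \<in> padic_ideal N"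
  by (simp add: padic_ideal_def)

lemma padic_ideal_uminus: "x \<in> padic_ideal N \<Longrightarrow> - x \<in> padic_ideal N"
  by (simp add: padic_ideal_def)

lemma padic_ideal_add: "x \<in> padic_ideal N \<Longrightarrow> y \<in> padic_ideal N \<Longrightarrow> x + y \<in> padic_ideal N"
  using padic_norm_add_le_max[of x y] by (auto simp: padic_ideal_def)

lemma padic_ideal_diff: "x \<in> padic_ideal N \<Longrightarrow> y \<in> padic_ideal N \<Longrightarrow> x - y \<in> padic_ideal N"
  using padic_ideal_add[of x N "- y"] padic_ideal_uminus[of y N] by simp

lemma padic_ideal_sum: "(\<And>i. i \<in> A \<Longrightarrow> f i \<in> padic_ideal N) \<Longrightarrow> sum f A \<in> padic_ideal N"
  by (induction A rule: infinite_finite_induct) (auto intro: padic_ideal_add)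

lemma padic_ideal_mult:
  fixes x y :: "'p::prime_card padic"
  assumes "x \<in> padic_ideal M" "y \<in> padic_ideal N"
  shows "x * y \<in> padic_ideal (M + N)"
proof -
  have "padic_norm x * padic_norm y \<le> inverse (real CARD('p) ^ M) * inverse (real CARD('p) ^ N)"
    using assms by (intro mult_mono) (auto simp: padic_ideal_def)
  then show ?thesis by (simp add: padic_ideal_def padic_norm_mult power_add)
qed

lemma padic_ideal_1_mult: "x \<in> padic_ideal 1 \<Longrightarrow> y \<in> padic_ideal 1 \<Longrightarrow> x * y \<in> padic_ideal 2"
  using padic_ideal_mult[of x 1 y 1] by (simp add: numeral_2_eq_2)

lemma padic_ideal_mult_left: "x \<in> padic_ints \<Longrightarrow> y \<in> padic_ideal N \<Longrightarrow> x * y \<in> padic_ideal N"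
  using padic_ideal_mult[of x 0 y N] by (simp add: padic_ints_eq_ideal)

lemma padic_ideal_mult_right: "x \<in> padic_ideal N \<Longrightarrow> y \<in> padic_ints \<Longrightarrow> x * y \<in> padic_ideal N"
  using padic_ideal_mult[of x N y 0] by (simp add: padic_ints_eq_ideal)

lemma padic_ideal_antimono:
  assumes "M \<le> N" shows "padic_ideal N \<subseteq> (padic_ideal M :: 'p::prime_card padic set)"
proof -
  have "inverse (real CARD('p) ^ N) \<le> inverse (real CARD('p) ^ M)"
    using assms CARD_real_gt_1[where 'p = 'p] by (intro le_imp_inverse_le power_increasing) auto
  then show ?thesis unfolding padic_ideal_def by (blast intro: order_trans)
qed

lemma padic_ideal_imp_ints: "x \<in> padic_ideal N \<Longrightarrow> x \<in> padic_ints"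
  using padic_ideal_antimono[of 0 N] by (auto simp: padic_ints_eq_ideal)

lemma padic_ints_add: "x \<in> padic_ints \<Longrightarrow> y \<in> padic_ints \<Longrightarrow> x + y \<in> padic_ints"
  unfolding padic_ints_eq_ideal by (rule padic_ideal_add)

lemma padic_ints_diff: "x \<in> padic_ints \<Longrightarrow> y \<in> padic_ints \<Longrightarrow> x - y \<in> padic_ints"
  unfolding padic_ints_eq_ideal by (rule padic_ideal_diff)

lemma padic_ints_uminus: "x \<in> padic_ints \<Longrightarrow> - x \<in> padic_ints"
  unfolding padic_ints_eq_ideal by (rule padic_ideal_uminus)

lemma padic_ints_sum: "(\<And>i. i \<in> A \<Longrightarrow> f i \<in> padic_ints) \<Longrightarrow> sum f A \<in> padic_ints"
  unfolding padic_ints_eq_ideal by (rule padic_ideal_sum)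

lemma padic_ints_mult: "x \<in> padic_ints \<Longrightarrow> y \<in> padic_ints \<Longrightarrow> x * y \<in> padic_ints"
  using padic_ideal_mult_left[of x y 0] by (simp add: padic_ints_eq_ideal)

lemma padic_ints_of_nat [simp]: "of_nat n \<in> padic_ints"
  using of_int_in_padic_ints[of "int n"] by simp

lemma padic_ints_0 [simp]: "0 \<in> padic_ints"
  by (simp add: padic_ints_def)

lemma padic_ints_1 [simp]: "1 \<in> padic_ints"
  using padic_ints_of_nat[of 1] by simp

lemma padic_ints_numeral [simp]: "numeral k \<in> padic_ints"
  using padic_ints_of_nat[of "numeral k"] by simp

lemma padic_ints_power: "x \<in> padic_ints \<Longrightarrow> x ^ n \<in> padic_ints"
  by (induction n) (auto intro: padic_ints_mult)

lemma padic_ints_divide: "x \<in> padic_ints \<Longrightarrow> padic_norm y = 1 \<Longrightarrow> x / y \<in> padic_ints"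
  using padic_norm_mult[of "x / y" y] by (cases "y = 0") (auto simp: padic_ints_def)

lemmas padic_ints_intros = padic_ints_add padic_ints_diff padic_ints_uminus padic_ints_sum
  padic_ints_mult padic_ints_of_nat padic_ints_1 padic_ints_numeral padic_ints_power padic_ints_divide

lemma padic_ideal_divide: "x \<in> padic_ideal N \<Longrightarrow> padic_norm y = 1 \<Longrightarrow> x / y \<in> padic_ideal N"
  using padic_ideal_mult_right[of x N "1 / y"] padic_ints_divide[of 1 y] by simp

lemma padic_ideal_mult_unit_iff: "padic_norm w = 1 \<Longrightarrow> w * x \<in> padic_ideal N \<longleftrightarrow> x \<in> padic_ideal N"
  by (simp add: padic_ideal_def padic_norm_mult)

lemma of_nat_CARD_in_padic_ideal: "of_nat CARD('p) \<in> (padic_ideal 1 :: 'p::prime_card padic set)"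
  by (simp add: padic_ideal_def padic_norm_CARD)

lemma padic_ideal_mult_cong:
  assumes "x - x' \<in> padic_ideal N" "y - y' \<in> padic_ideal N" "x \<in> padic_ints" "y' \<in> padic_ints"
  shows "x * y - x' * y' \<in> padic_ideal N"
proof -
  have "x * y - x' * y' = x * (y - y') + (x - x') * y'" by (simp add: algebra_simps)
  then show ?thesis
    using assms by (auto intro: padic_ideal_add padic_ideal_mult_left padic_ideal_mult_right)
qed

lemma padic_norm_of_nat_coprime:
  assumes "\<not> CARD('p::prime_card) dvd n"
  shows "padic_norm (of_nat n :: 'p padic) = 1"
proof -
  have "n \<noteq> 0" using assms by (metis dvd_0_right)
  moreover have "multiplicity (int CARD('p)) (int n) = 0"
    using assms by (intro not_dvd_imp_multiplicity_0) simp
  ultimately show ?thesis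
    using padic_norm_of_rat_of_int[of "int n", where 'p = 'p]
      padic_abs_of_int_divide[OF CARD_prime[where 'p = 'p], of "int n" 1] by simp
qed

lemma padic_norm_fact:
  assumes "n < CARD('p::prime_card)" shows "padic_norm (fact n :: 'p padic) = 1"
proof -
  have "\<not> CARD('p) dvd fact n"
    using assms by (simp add: prime_dvd_fact_iff CARD_prime not_le)
  then show ?thesis using padic_norm_of_nat_coprime[of "fact n", where 'p = 'p] by simp
qed

section \<open>Rising factorials and p-adic powers modulo p^N\<close>

lemma padic_ints_pochhammer: "x \<in> padic_ints \<Longrightarrow> pochhammer x n \<in> padic_ints"
  by (induction n) (auto simp: pochhammer_Suc intro!: padic_ints_intros)

lemma padic_ideal_pochhammer:
  assumes "x \<in> padic_ints" "x + of_nat j \<in> padic_ideal N" "j < n"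
  shows "pochhammer x n \<in> padic_ideal N"
  using assms(3)
proof (induction n)
  case (Suc n)
  show ?case
  proof (cases "j = n")
    case True
    then show ?thesis using assms(1,2)
      by (simp add: pochhammer_Suc padic_ideal_mult_left padic_ints_pochhammer)
  next
    case False
    then show ?thesis using Suc assms(1)
      by (auto simp: pochhammer_Suc intro!: padic_ideal_mult_right padic_ints_intros)
  qed
qed simp

lemma padic_pochhammer_cong:
  assumes "x - y \<in> padic_ideal N" "x \<in> padic_ints" "y \<in> padic_ints"
  shows "pochhammer x n - pochhammer y n \<in> padic_ideal N"
proof (induction n)
  case (Suc n)
  show ?case
    unfolding pochhammer_Suc
    by (rule padic_ideal_mult_cong[OF Suc]) (use assms in \<open>auto intro!: padic_ints_intros padic_ints_pochhammer\<close>)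
qed simp

text \<open>A late member of the sequence differs from the limit by an element of the ideal. This
  carries divisibility from partial sums to the infinite series in \<open>padic_power\<close>; the
  first \<open>k\<close> members may be ignored.\<close>

lemma padic_ideal_closed:
  fixes x :: "'p::prime_card padic"
  assumes "X \<longlonglongrightarrow> x" "\<And>n. n \<ge> k \<Longrightarrow> X n \<in> padic_ideal N"
  shows "x \<in> padic_ideal N"
proof -
  have "inverse (real CARD('p) ^ N) > 0" using CARD_real_gt_1[where 'p = 'p] by simp
  from metric_LIMSEQ_D[OF assms(1) this] obtain M
    where "\<forall>n\<ge>M. dist (X n) x < inverse (real CARD('p) ^ N)" by blast
  then have "X (max k M) - x \<in> padic_ideal N"
    by (simp add: dist_padic_def padic_ideal_def less_imp_le)
  then show ?thesis
    using padic_ideal_diff[OF assms(2)[of "max k M"]] by fastforce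
qed

lemma padic_units_fermat:
  fixes w :: "'p::prime_card padic"
  assumes "w \<in> padic_units"
  shows "w ^ (CARD('p) - 1) - 1 \<in> padic_ideal 1"
  using padic_fermat[OF assms] padic_cong_iff_ideal[of 1 "w ^ (CARD('p) - 1)" 1] by simp

text \<open>By Fermat, w^(p-1) - 1 is divisible by p, and the generalized binomial coefficients of s
  are integral. Hence all terms of the binomial series from the quadratic one on vanish modulo
  p^2.\<close>

lemma padic_power_cong:
  fixes w s :: "'p::prime_card padic"
  assumes w: "w \<in> padic_units" and s: "s \<in> padic_ints"
  shows "padic_power w (int b, s) - w ^ b * (1 + s * (w ^ (CARD('p) - 1) - 1)) \<in> padic_ideal 2"
proof -
  define h where "h = w ^ (CARD('p) - 1) - 1"
  define f where "f k = (s gchoose k) * h ^ k" for k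
  have h: "h \<in> padic_ideal 1" using padic_units_fermat[OF w] by (simp add: h_def)
  have g: "(s gchoose k) \<in> padic_ints" for k
    using padic_norm_gchoose_le_1[OF s] by (simp add: padic_ints_def)
  have "(\<lambda>n. sum f {..<n}) \<longlonglongrightarrow> suminf f"
    unfolding f_def h_def by (rule summable_LIMSEQ[OF padic_power_summable[OF w s]])
  then have lim: "(\<lambda>n. sum f {..<n} - (1 + s * h)) \<longlonglongrightarrow> suminf f - (1 + s * h)"
    unfolding tendsto_dist_iff[of _ "suminf f"] tendsto_dist_iff[of _ "suminf f - _"]
    by (simp add: dist_padic_def)
  have "suminf f - (1 + s * h) \<in> padic_ideal 2"
  proof (rule padic_ideal_closed[OF lim])
    fix n :: nat assume "n \<ge> 2"
    then have "{..<n} = {0, 1} \<union> {2..<n}" by auto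
    then have "sum f {..<n} = f 0 + f 1 + sum f {2..<n}" by (simp add: sum.union_disjoint)
    then have "sum f {..<n} - (1 + s * h) = sum f {2..<n}" by (simp add: f_def)
    moreover have "sum f {2..<n} \<in> padic_ideal 2"
    proof (rule padic_ideal_sum)
      fix k assume "k \<in> {2..<n}"
      then obtain j where "k = 2 + j" by (auto dest: le_Suc_ex)
      then have "f k = (s gchoose k) * h ^ j * (h * h)" by (simp add: f_def)
      moreover have "h * h \<in> padic_ideal 2" by (rule padic_ideal_1_mult[OF h h])
      ultimately show "f k \<in> padic_ideal 2"
        using g padic_ideal_imp_ints[OF h] by (auto intro!: padic_ideal_mult_left padic_ints_intros)
    qed
    ultimately show "sum f {..<n} - (1 + s * h) \<in> padic_ideal 2" by simp
  qed
  then have "w ^ b * (suminf f - (1 + s * h)) \<in> padic_ideal 2"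
    using w by (intro padic_ideal_mult_left padic_ints_power) (auto simp: padic_units_def)
  then show ?thesis
    unfolding padic_power_def f_def[abs_def] h_def
    by (simp only: right_diff_distrib fst_conv snd_conv power_int_of_nat mult.assoc)
qed

lemma padic_unitsI: "padic_norm x = 1 \<Longrightarrow> x \<in> padic_units"
  using padic_ints_divide[of 1 x]
  by (cases "x = 0") (auto simp: padic_units_def padic_ints_def intro!: exI[of _ "1 / x"])

lemma padic_residue:
  fixes x :: "'p::prime_card padic"
  assumes "x \<in> padic_ints"
  shows "padic_residue x \<in> {0..<int CARD('p)}" "x - of_int (padic_residue x) \<in> padic_ideal 1"
  using theI'[OF padic_residue_ex1[OF assms]] padic_cong_iff_ideal[of 1 x "of_int (padic_residue x)"]
  unfolding padic_residue_def by auto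

text \<open>The residue of x is nonzero, hence prime to p and of norm 1, while x differs from it by
  something of norm below 1; the ultrametric inequality concludes. This makes 1-z a unit.\<close>

lemma padic_norm_eq_1I:
  fixes x :: "'p::prime_card padic"
  assumes "x \<in> padic_ints" "x \<notin> padic_ideal 1"
  shows "padic_norm x = 1"
proof -
  obtain i where i: "i \<in> {0..<int CARD('p)}" "x - of_int i \<in> padic_ideal 1"
    using padic_residue[OF assms(1)] by blast
  define n where "n = nat i"
  have n: "of_int i = (of_nat n :: 'p padic)" using i by (simp add: n_def)
  have "n \<noteq> 0" using i(2) assms(2) n by (metis diff_zero of_nat_0)
  then have "\<not> CARD('p) dvd n" using i(1) by (auto simp: n_def dest: dvd_imp_le)
  then have "1 = padic_norm (of_nat n :: 'p padic)" by (simp add: padic_norm_of_nat_coprime)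
  also have "\<dots> \<le> max (padic_norm (- (x - of_nat n))) (padic_norm x)"
    using padic_norm_add_le_max[of "- (x - of_nat n)" x] by simp
  finally have "1 \<le> padic_norm (x - of_nat n) \<or> 1 \<le> padic_norm x"
    by (simp only: padic_norm_minus le_max_iff_disj)
  moreover have "padic_norm (x - of_nat n) < 1"
  proof -
    have "padic_norm (x - of_nat n) \<le> inverse (real CARD('p))"
      using i(2) n by (simp add: padic_ideal_def)
    also have "\<dots> < 1" using CARD_real_gt_1[where 'p = 'p] by (simp add: inverse_less_1_iff)
    finally show ?thesis .
  qed
  ultimately show ?thesis using assms(1) by (simp add: padic_ints_def)
qed

lemma padic_idealE:
  fixes x :: "'p::prime_card padic"
  assumes "x \<in> padic_ideal N"
  obtains u where "u \<in> padic_ints" "x = of_nat CARD('p) ^ N * u"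
  using assms padic_cong_iff_ideal[of N x 0] by (auto simp: padic_cong_def)

subsection \<open>The transformation modulo $p^2$\<close>

lemma sum_atMost_split_0: "(\<Sum>i\<le>n. g i) = g 0 + (\<Sum>i\<in>{1..n}. g i)" for g :: "nat \<Rightarrow> 'a::comm_monoid_add"
  by (simp add: sum.atMost_shift sum.atLeast1_atMost_eq lessThan_Suc_atMost)

lemma sum_triangle_diagonal:
  fixes h :: "nat \<Rightarrow> nat \<Rightarrow> 'a::comm_monoid_add"
  shows "(\<Sum>k\<le>n. \<Sum>i\<le>k. h i (k - i)) = (\<Sum>i\<le>n. \<Sum>j\<le>n - i. h i j)"
proof -
  have "{(i, j). i + j \<le> n} = Sigma {..n} (\<lambda>i. {..n - i})" by auto
  then show ?thesis
    using sum.triangle_reindex_eq[of h n] by (simp add: sum.Sigma)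
qed

lemma padic_ints_bincoeff:
  "c \<in> padic_ints \<Longrightarrow> n < CARD('p) \<Longrightarrow> bincoeff c n \<in> (padic_ints :: 'p::prime_card padic set)"
  unfolding bincoeff_def
  by (intro padic_ints_divide padic_ints_pochhammer padic_ints_uminus padic_norm_fact)

lemma bincoeff_of_nat_eq_0: "N < n \<Longrightarrow> bincoeff (of_nat N) n = 0"
  by (simp add: bincoeff_of_nat)

text \<open>The expansion of (1-X)^(pt) below X^p. Splitting off the first factor -pt of the rising
  factorial leaves one that is congruent to (i-1)! modulo p, and the factor pt raises this to a
  congruence modulo p^2.\<close>

lemma bincoeff_CARD_mult_cong:
  fixes t :: "'p::prime_card padic"
  assumes t: "t \<in> padic_ints" and i: "0 < i" "i < CARD('p)"
  shows "bincoeff (of_nat CARD('p) * t) i + of_nat CARD('p) * t / of_nat i \<in> padic_ideal 2"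
proof -
  obtain j where j: "i = Suc j" using i by (cases i) auto
  let ?s = "of_nat CARD('p) * t"
  have s: "?s \<in> padic_ideal 1" by (rule padic_ideal_mult_right[OF of_nat_CARD_in_padic_ideal t])
  have "pochhammer 1 j - pochhammer (1 - ?s) j \<in> padic_ideal 1"
    using s by (intro padic_pochhammer_cong padic_ints_intros t) auto
  from padic_ideal_1_mult[OF s this]
  have "?s * (fact j - pochhammer (1 - ?s) j) \<in> padic_ideal 2"
    by (simp add: pochhammer_fact)
  then have "?s * (fact j - pochhammer (1 - ?s) j) / fact i \<in> padic_ideal 2"
    using i by (intro padic_ideal_divide padic_norm_fact)
  moreover have "bincoeff ?s i + ?s / of_nat i = ?s * (fact j - pochhammer (1 - ?s) j) / fact i"
  proof -
    have nz: "of_nat (Suc j) \<noteq> (0 :: 'p padic)" by (simp del: of_nat_Suc)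
    have "pochhammer (- ?s) (Suc j) = - ?s * pochhammer (1 - ?s) j"
      by (simp only: pochhammer_rec) (simp add: add.commute)
    then show ?thesis
      using nz unfolding j bincoeff_def by (simp add: field_simps del: of_nat_Suc)
  qed
  ultimately show ?thesis by simp
qed

lemma padic_norm_2:
  assumes "odd CARD('p::prime_card)" shows "padic_norm (2 :: 'p padic) = 1"
proof -
  have "\<not> CARD('p) dvd 2"
  proof
    assume "CARD('p) dvd 2"
    then have "CARD('p) \<le> 2" by (intro dvd_imp_le) auto
    then show False using assms prime_ge_2_nat[OF CARD_prime[where 'p = 'p]] by simp
  qed
  then show ?thesis using padic_norm_of_nat_coprime[of 2, where 'p = 'p] by simp
qed

definition hyp_coeff :: "'a::field_char_0 \<Rightarrow> nat \<Rightarrow> 'a" where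
  "hyp_coeff \<alpha> n = (pochhammer \<alpha> n / fact n)\<^sup>2"

section \<open>The coefficients V and Q for \<alpha> = pt - a\<close>

context
  fixes \<alpha> t :: "'p::prime_card padic" and m a :: nat
  assumes p: "CARD('p) = Suc (2 * m)" and a: "even a" "a \<le> 2 * m"
    and t: "t \<in> padic_ints" and \<alpha>: "\<alpha> = of_nat CARD('p) * t - of_nat a"
begin

text \<open>The coefficient of $X^n$ in $(1-X)^{2m-a} F(\alpha,\alpha;1;X)$.\<close>

definition V :: "nat \<Rightarrow> 'p padic" where
  "V n = (\<Sum>i\<le>n. bincoeff (of_nat (2 * m - a)) i * hyp_coeff \<alpha> (n - i))"

text \<open>The coefficient of $X^n$ in $X^k (1-X)^{2m-2k}$.\<close>

definition shifted_bincoeff :: "nat \<Rightarrow> nat \<Rightarrow> 'p padic" where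
  "shifted_bincoeff k n = (if k \<le> n then bincoeff (of_nat (2 * m - 2 * k)) (n - k) else 0)"

text \<open>
  The coefficient of $X^n$ in $(1-X)^{2m} F(\frac{\alpha}{2},\frac{1-\alpha}{2};1;-4X/(1-X)^2)$; the terms with
  $k > m$, which vanish modulo $p^2$, are omitted to make this a palindromic polynomial.
\<close>

definition Q :: "nat \<Rightarrow> 'p padic" where
  "Q n = (\<Sum>k\<le>m. quad_coeff \<alpha> k * shifted_bincoeff k n)"

text \<open>Division by zero gives \<open>recip 0 = 0\<close>, so that sums may start at $i = 0$.\<close>

definition recip :: "nat \<Rightarrow> 'p padic" where
  "recip i = 1 / of_nat i"

text \<open>The coefficient of X^n in -log(1-X) times the series of the \<open>V j\<close>; up to
  the factor pt it is the first order discrepancy between \<open>V n\<close> and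
  \<open>Q n\<close>.\<close>

definition VL :: "nat \<Rightarrow> 'p padic" where
  "VL n = (\<Sum>i\<le>n. recip i * V (n - i))"

lemma CARD_mult_t_ideal: "of_nat CARD('p) * t \<in> padic_ideal 1"
  by (rule padic_ideal_mult_right[OF of_nat_CARD_in_padic_ideal t])

lemma alpha_ints: "\<alpha> \<in> padic_ints"
  unfolding \<alpha> by (intro padic_ints_intros t)

lemma norm_2: "padic_norm (2 :: 'p padic) = 1"
  using p by (intro padic_norm_2) simp

lemma norm_fact: "n \<le> 2 * m \<Longrightarrow> padic_norm (fact n :: 'p padic) = 1"
  using p by (intro padic_norm_fact) simp

lemma half_ints: "x \<in> padic_ints \<Longrightarrow> x / 2 \<in> (padic_ints :: 'p padic set)"
  by (rule padic_ints_divide[OF _ norm_2])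

lemma hyp_coeff_ints: "n \<le> 2 * m \<Longrightarrow> hyp_coeff \<alpha> n \<in> padic_ints"
  unfolding hyp_coeff_def by (intro padic_ints_intros padic_ints_pochhammer alpha_ints norm_fact)

text \<open>For n > a the rising factorial contains \<alpha>+a = pt, and the coefficient is a
  square.\<close>

lemma hyp_coeff_ideal:
  assumes "a < n" "n \<le> 2 * m"
  shows "hyp_coeff \<alpha> n \<in> padic_ideal 2"
proof -
  have "pochhammer \<alpha> n \<in> padic_ideal 1"
    using assms CARD_mult_t_ideal by (intro padic_ideal_pochhammer[of _ a] alpha_ints) (simp_all add: \<alpha>)
  then have "pochhammer \<alpha> n / fact n \<in> padic_ideal 1"
    using assms by (intro padic_ideal_divide norm_fact)
  then show ?thesis
    unfolding hyp_coeff_def power2_eq_square by (intro padic_ideal_1_mult)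
qed

lemma quad_coeff_ints:
  assumes "k \<le> 2 * m"
  shows "quad_coeff \<alpha> k \<in> padic_ints"
  unfolding quad_coeff_def using assms
  by (intro padic_ints_intros padic_ints_pochhammer half_ints alpha_ints)
     (simp add: padic_norm_power norm_fact)

text \<open>With a = 2b, the first rising factorial contains \<alpha>/2 + b = pt/2 and the second
  (1-\<alpha>)/2 + (m-b) = (p-pt)/2, since b and m-b are at most m < k. Each contributes a factor
  p.\<close>

lemma quad_coeff_ideal:
  assumes "m < k" "k \<le> 2 * m"
  shows "quad_coeff \<alpha> k \<in> padic_ideal 2"
proof -
  obtain b where b: "a = 2 * b" using a by auto
  have 2: "x \<in> padic_ideal 1 \<Longrightarrow> x / 2 \<in> (padic_ideal 1 :: 'p padic set)" for x
    by (rule padic_ideal_divide[OF _ norm_2])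
  have "\<alpha> / 2 + of_nat b = of_nat CARD('p) * t / 2"
    by (simp add: \<alpha> b field_simps)
  then have "\<alpha> / 2 + of_nat b \<in> padic_ideal 1" by (simp only: 2[OF CARD_mult_t_ideal])
  then have 3: "pochhammer (\<alpha> / 2) k \<in> padic_ideal 1"
    using assms a b by (intro padic_ideal_pochhammer[of _ b] half_ints alpha_ints) simp_all
  have "(1 - \<alpha>) / 2 + of_nat (m - b) = (of_nat CARD('p) - of_nat CARD('p) * t) / 2"
    using a(2) by (simp add: \<alpha> b p of_nat_diff field_simps)
  then have "(1 - \<alpha>) / 2 + of_nat (m - b) \<in> padic_ideal 1"
    by (simp only: 2[OF padic_ideal_diff[OF of_nat_CARD_in_padic_ideal CARD_mult_t_ideal]])
  then have 4: "pochhammer ((1 - \<alpha>) / 2) k \<in> padic_ideal 1"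
    using assms a b by (intro padic_ideal_pochhammer[of _ "m - b"] half_ints padic_ints_diff alpha_ints) simp_all
  show ?thesis
    unfolding quad_coeff_def using assms
    by (intro padic_ideal_divide padic_ideal_mult_left[OF _ padic_ideal_1_mult[OF 3 4]]
        padic_ints_power padic_ints_uminus padic_ints_numeral)
       (simp_all add: padic_norm_power norm_fact)
qed

lemma V_ints: "n \<le> 2 * m \<Longrightarrow> V n \<in> padic_ints"
  unfolding V_def using p
  by (intro padic_ints_sum padic_ints_mult padic_ints_bincoeff hyp_coeff_ints padic_ints_of_nat) auto

lemma recip_ints: "i \<le> 2 * m \<Longrightarrow> recip i \<in> padic_ints"
proof (cases "i = 0")
  case False
  assume "i \<le> 2 * m"
  then have "\<not> CARD('p) dvd i" using False p by (auto dest: dvd_imp_le)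
  then show ?thesis unfolding recip_def by (intro padic_ints_divide padic_norm_of_nat_coprime) auto
qed (simp add: recip_def padic_ints_def)

text \<open>Because pt + (2m-a) = \<alpha> + 2m, associativity of the power series product reduces
  the left side to \<open>bincoeff_convolution\<close> with d = 2m.\<close>

lemma V_convolution:
  "(\<Sum>i\<le>n. bincoeff (of_nat CARD('p) * t) i * V (n - i))
    = (\<Sum>k\<le>n. quad_coeff \<alpha> k * bincoeff (of_nat (2 * m) - 2 * of_nat k) (n - k))"
proof -
  let ?s = "of_nat CARD('p) * t" and ?N = "of_nat (2 * m - a) :: 'p padic"
  have s: "?s + ?N = \<alpha> + of_nat (2 * m)" using a by (simp add: \<alpha> of_nat_diff)
  define A B C where "A = Abs_fps (bincoeff ?s)" and "B = Abs_fps (bincoeff ?N)" and "C = Abs_fps (hyp_coeff \<alpha>)"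
  have AB: "A * B = Abs_fps (bincoeff (?s + ?N))"
    by (rule fps_ext) (simp add: A_def B_def fps_mult_nth atLeast0AtMost bincoeff_vandermonde)
  have BC: "B * C = Abs_fps V"
    by (rule fps_ext) (simp add: B_def C_def fps_mult_nth atLeast0AtMost V_def)
  have "(\<Sum>i\<le>n. bincoeff ?s i * V (n - i)) = fps_nth (A * (B * C)) n"
    unfolding BC by (simp add: A_def fps_mult_nth atLeast0AtMost)
  also have "\<dots> = fps_nth (A * B * C) n" by (simp only: mult.assoc)
  also have "\<dots> = (\<Sum>i\<le>n. bincoeff (\<alpha> + of_nat (2 * m)) i * hyp_coeff \<alpha> (n - i))"
    unfolding AB s by (simp add: C_def fps_mult_nth atLeast0AtMost)
  finally show ?thesis unfolding hyp_coeff_def bincoeff_convolution .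
qed

text \<open>In \<open>V_convolution\<close>, the right side loses its terms with k > m modulo p^2
  and becomes \<open>Q n\<close>; on the left, (1-X)^(pt) is replaced by its first order
  expansion.\<close>

lemma V_cong_Q:
  assumes n: "n \<le> 2 * m"
  shows "V n - Q n - of_nat CARD('p) * t * VL n \<in> padic_ideal 2"
proof -
  let ?s = "of_nat CARD('p) * t"
  \<comment> \<open>Extension by zero makes the range of k independent of n. The exponent 2m-2k is
    formed in the field, since it is negative for k > m; for k \<le> m the value is
    \<open>shifted_bincoeff k n\<close>.\<close>
  define b where "b k = (if k \<le> n then bincoeff (of_nat (2 * m) - 2 * of_nat k) (n - k) else 0 :: 'p padic)" for k
  have "(\<Sum>k\<le>n. quad_coeff \<alpha> k * bincoeff (of_nat (2 * m) - 2 * of_nat k) (n - k))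
      = (\<Sum>k\<le>2 * m. quad_coeff \<alpha> k * b k)"
    using n by (intro sum.mono_neutral_cong_left) (auto simp: b_def)
  also have "{..2 * m} = {..m} \<union> {m<..2 * m}" by auto
  also have "(\<Sum>k\<in>\<dots>. quad_coeff \<alpha> k * b k) = (\<Sum>k\<le>m. quad_coeff \<alpha> k * b k) + (\<Sum>k\<in>{m<..2 * m}. quad_coeff \<alpha> k * b k)"
    by (rule sum.union_disjoint) auto
  also have "(\<Sum>k\<le>m. quad_coeff \<alpha> k * b k) = Q n"
    unfolding Q_def by (intro sum.cong) (auto simp: b_def shifted_bincoeff_def of_nat_diff)
  finally have conv: "(\<Sum>i\<le>n. bincoeff ?s i * V (n - i)) = Q n + (\<Sum>k\<in>{m<..2 * m}. quad_coeff \<alpha> k * b k)"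
    unfolding V_convolution .
  have b_ints: "b k \<in> padic_ints" for k
    unfolding b_def using n p by (auto simp del: of_nat_mult intro!: padic_ints_bincoeff padic_ints_diff padic_ints_mult)
  have high: "(\<Sum>k\<in>{m<..2 * m}. quad_coeff \<alpha> k * b k) \<in> padic_ideal 2"
    by (intro padic_ideal_sum padic_ideal_mult_right quad_coeff_ideal b_ints) auto
  have low: "(\<Sum>i\<in>{1..n}. (bincoeff ?s i + ?s / of_nat i) * V (n - i)) \<in> padic_ideal 2"
    using n p by (intro padic_ideal_sum padic_ideal_mult_right V_ints bincoeff_CARD_mult_cong t) auto
  have "(\<Sum>i\<in>{1..n}. (bincoeff ?s i + ?s / of_nat i) * V (n - i))
      = (\<Sum>i\<in>{1..n}. bincoeff ?s i * V (n - i)) + ?s * VL n"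
    unfolding VL_def sum_atMost_split_0 by (simp add: recip_def sum.distrib sum_distrib_left algebra_simps)
  moreover have "(\<Sum>i\<le>n. bincoeff ?s i * V (n - i)) = V n + (\<Sum>i\<in>{1..n}. bincoeff ?s i * V (n - i))"
    unfolding sum_atMost_split_0 by (simp add: bincoeff_def)
  ultimately have "V n - Q n - ?s * VL n = (\<Sum>k\<in>{m<..2 * m}. quad_coeff \<alpha> k * b k)
      - (\<Sum>i\<in>{1..n}. (bincoeff ?s i + ?s / of_nat i) * V (n - i))"
    using conv by (simp add: algebra_simps)
  then show ?thesis using padic_ideal_diff[OF high low] by simp
qed

lemma VL_ints: "n \<le> 2 * m \<Longrightarrow> VL n \<in> padic_ints"
  unfolding VL_def by (intro padic_ints_sum padic_ints_mult recip_ints V_ints) auto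

lemma V_cong_Q_1:
  assumes n: "n \<le> 2 * m"
  shows "V n - Q n \<in> padic_ideal 1"
proof -
  have "of_nat CARD('p) * t * VL n \<in> padic_ideal 1"
    by (rule padic_ideal_mult_right[OF CARD_mult_t_ideal VL_ints[OF n]])
  moreover have "V n - Q n - of_nat CARD('p) * t * VL n \<in> padic_ideal 1"
    using V_cong_Q[OF n] padic_ideal_antimono[of 1 2] by auto
  ultimately show ?thesis using padic_ideal_add by fastforce
qed

text \<open>The polynomial X^k (1-X)^(2m-2k) is unchanged by f(X) -> X^(2m) f(1/X), as the exponent
  of 1-X is even.\<close>

lemma shifted_bincoeff_symmetric:
  assumes "k \<le> m" "n \<le> 2 * m"
  shows "shifted_bincoeff k (2 * m - n) = shifted_bincoeff k n"
proof (cases "k \<le> n \<and> k \<le> 2 * m - n")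
  case True
  then have k: "k \<le> n" "k \<le> 2 * m - n" by auto
  have "2 * m - n - k + (n - k) = 2 * (m - k)" using k assms by auto
  then have "even (2 * m - n - k) \<longleftrightarrow> even (n - k)" by (metis dvd_triv_left even_add)
  then have sign: "(-1) ^ (2 * m - n - k) = ((-1) ^ (n - k) :: 'p padic)"
    by (simp add: minus_one_power_iff)
  have "2 * m - n - k = (2 * m - 2 * k) - (n - k)" "n - k \<le> 2 * m - 2 * k" using k assms by auto
  then have choose: "2 * m - 2 * k choose (2 * m - n - k) = 2 * m - 2 * k choose (n - k)"
    by (metis binomial_symmetric)
  show ?thesis
    by (simp only: shifted_bincoeff_def bincoeff_of_nat k if_True sign choose)
next
  \<comment> \<open>If one of the two indices is below k, the other exceeds 2m-k, so both
    coefficients are 0.\<close>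
  case False
  then show ?thesis
    using assms
    by (auto simp: shifted_bincoeff_def simp del: of_nat_diff intro!: bincoeff_of_nat_eq_0 bincoeff_of_nat_eq_0[symmetric])
qed

lemma Q_symmetric: "n \<le> 2 * m \<Longrightarrow> Q (2 * m - n) = Q n"
  unfolding Q_def by (intro sum.cong refl) (simp add: shifted_bincoeff_symmetric)

text \<open>V agrees with Q modulo p and inherits its symmetry there.\<close>

lemma V_symmetric:
  assumes "n \<le> 2 * m"
  shows "V n - V (2 * m - n) \<in> padic_ideal 1"
  using padic_ideal_diff[OF V_cong_Q_1[OF assms] V_cong_Q_1[of "2 * m - n"]] Q_symmetric[OF assms] by simp

text \<open>The left sum is the product on the right cut off above degree 2m. A lost term has i+j >
  2m; either i > 2m-a and the binomial coefficient is 0, or j > a and \<open>hyp_coeff_ideal\<close>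
  applies.\<close>

lemma sum_V_power:
  assumes x: "x \<in> padic_ints"
  shows "(\<Sum>n\<le>2 * m. V n * x ^ n) - (1 - x) ^ (2 * m - a) * (\<Sum>n\<le>2 * m. hyp_coeff \<alpha> n * x ^ n) \<in> padic_ideal 2"
proof -
  let ?B = "bincoeff (of_nat (2 * m - a)) :: nat \<Rightarrow> 'p padic"
  define h where "h i j = ?B i * hyp_coeff \<alpha> j * x ^ (i + j)" for i j
  have "(\<Sum>n\<le>2 * m. V n * x ^ n) = (\<Sum>n\<le>2 * m. \<Sum>i\<le>n. h i (n - i))"
    by (simp add: V_def h_def sum_distrib_right)
  also have "\<dots> = (\<Sum>i\<le>2 * m. \<Sum>j\<le>2 * m - i. h i j)" by (rule sum_triangle_diagonal)
  finally have 1: "(\<Sum>n\<le>2 * m. V n * x ^ n) = (\<Sum>i\<le>2 * m. \<Sum>j\<le>2 * m - i. h i j)" .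
  have W: "(1 - x) ^ (2 * m - a) = (\<Sum>i\<le>2 * m. ?B i * x ^ i)"
    unfolding power_one_minus_eq_sum
    by (intro sum.mono_neutral_left) (auto simp: bincoeff_of_nat_eq_0)
  have 2: "(1 - x) ^ (2 * m - a) * (\<Sum>n\<le>2 * m. hyp_coeff \<alpha> n * x ^ n) = (\<Sum>i\<le>2 * m. \<Sum>j\<le>2 * m. h i j)"
    unfolding W sum_product h_def by (simp add: power_add ac_simps)
  have 3: "(\<Sum>j\<le>2 * m. h i j) = (\<Sum>j\<le>2 * m - i. h i j) + (\<Sum>j\<in>{2 * m - i<..2 * m}. h i j)" for i
  proof -
    have "{..2 * m} = {..2 * m - i} \<union> {2 * m - i<..2 * m}" by auto
    then show ?thesis by (simp only:) (rule sum.union_disjoint, auto)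
  qed
  have "(\<Sum>i\<le>2 * m. \<Sum>j\<in>{2 * m - i<..2 * m}. h i j) \<in> padic_ideal 2"
  proof (intro padic_ideal_sum)
    fix i j assume ij: "i \<in> {..2 * m}" "j \<in> {2 * m - i<..2 * m}"
    show "h i j \<in> padic_ideal 2"
    proof (cases "2 * m - a < i")
      case False
      then have "hyp_coeff \<alpha> j \<in> padic_ideal 2" using ij a by (intro hyp_coeff_ideal) auto
      moreover have "?B i \<in> padic_ints"
        using ij p by (intro padic_ints_bincoeff padic_ints_of_nat) auto
      ultimately show ?thesis
        unfolding h_def by (metis padic_ideal_mult_right padic_ideal_mult_left padic_ints_power x)
    qed (simp add: h_def bincoeff_of_nat_eq_0)
  qed
  then show ?thesis unfolding 1 2 3 using padic_ideal_uminus by (fastforce simp: sum.distrib)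
qed

lemma sum_shifted_bincoeff_power:
  assumes "k \<le> m"
  shows "(\<Sum>n\<le>2 * m. shifted_bincoeff k n * x ^ n) = x ^ k * (1 - x) ^ (2 * m - 2 * k)"
proof -
  have "x ^ k * (1 - x) ^ (2 * m - 2 * k)
      = (\<Sum>i\<le>2 * m - 2 * k. shifted_bincoeff k (i + k) * x ^ (i + k))"
    unfolding power_one_minus_eq_sum sum_distrib_left
    by (intro sum.cong) (auto simp: shifted_bincoeff_def power_add)
  also have "\<dots> = (\<Sum>n\<in>{k..2 * m - k}. shifted_bincoeff k n * x ^ n)"
    using assms by (intro sum.reindex_bij_witness[of _ "\<lambda>n. n - k" "\<lambda>i. i + k"]) auto
  also have "\<dots> = (\<Sum>n\<le>2 * m. shifted_bincoeff k n * x ^ n)"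
    using assms
    by (intro sum.mono_neutral_left)
       (auto simp: shifted_bincoeff_def not_le simp del: of_nat_diff intro!: bincoeff_of_nat_eq_0)
  finally show ?thesis ..
qed

text \<open>For y = x/(1-x)^2 and k \<le> m, (1-x)^(2m) y^k = x^k (1-x)^(2m-2k), so the part up to m
  is an exact equality; the terms with k > m vanish modulo p^2.\<close>

lemma sum_Q_power:
  assumes x: "x \<in> padic_ints" "padic_norm (1 - x) = 1"
  shows "(\<Sum>n\<le>2 * m. Q n * x ^ n)
    - (1 - x) ^ (2 * m) * (\<Sum>k\<le>2 * m. quad_coeff \<alpha> k * (x / (1 - x)\<^sup>2) ^ k) \<in> padic_ideal 2"
proof -
  let ?y = "x / (1 - x)\<^sup>2"
  have nz: "1 - x \<noteq> 0" using x(2) by auto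
  have "(\<Sum>n\<le>2 * m. Q n * x ^ n) = (\<Sum>k\<le>m. quad_coeff \<alpha> k * (\<Sum>n\<le>2 * m. shifted_bincoeff k n * x ^ n))"
    unfolding Q_def sum_distrib_right sum_distrib_left by (subst sum.swap) (simp add: mult.assoc)
  also have "\<dots> = (\<Sum>k\<le>m. (1 - x) ^ (2 * m) * (quad_coeff \<alpha> k * ?y ^ k))"
  proof (intro sum.cong refl)
    fix k assume "k \<in> {..m}"
    then have "(1 - x) ^ (2 * m) = (1 - x) ^ (2 * m - 2 * k) * ((1 - x)\<^sup>2) ^ k"
      by (simp flip: power_add power_mult)
    then show "quad_coeff \<alpha> k * (\<Sum>n\<le>2 * m. shifted_bincoeff k n * x ^ n)
        = (1 - x) ^ (2 * m) * (quad_coeff \<alpha> k * ?y ^ k)"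
      using \<open>k \<in> {..m}\<close> nz by (simp add: sum_shifted_bincoeff_power power_divide)
  qed
  finally have 1: "(\<Sum>n\<le>2 * m. Q n * x ^ n) = (1 - x) ^ (2 * m) * (\<Sum>k\<le>m. quad_coeff \<alpha> k * ?y ^ k)"
    by (simp add: sum_distrib_left)
  have "{..2 * m} = {..m} \<union> {m<..2 * m}" by auto
  then have 2: "(\<Sum>k\<le>2 * m. quad_coeff \<alpha> k * ?y ^ k)
      = (\<Sum>k\<le>m. quad_coeff \<alpha> k * ?y ^ k) + (\<Sum>k\<in>{m<..2 * m}. quad_coeff \<alpha> k * ?y ^ k)"
    by (simp only:) (rule sum.union_disjoint, auto)
  have "?y \<in> padic_ints" using x by (intro padic_ints_divide) (auto simp: padic_norm_power)
  then have "(\<Sum>k\<in>{m<..2 * m}. quad_coeff \<alpha> k * ?y ^ k) \<in> padic_ideal 2"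
    by (intro padic_ideal_sum padic_ideal_mult_right quad_coeff_ideal padic_ints_power) auto
  then have "(1 - x) ^ (2 * m) * (\<Sum>k\<in>{m<..2 * m}. quad_coeff \<alpha> k * ?y ^ k) \<in> padic_ideal 2"
    using x by (intro padic_ideal_mult_left padic_ints_power padic_ints_diff) auto
  then show ?thesis unfolding 1 2 using padic_ideal_uminus by (fastforce simp: distrib_left)
qed

section \<open>The truncated logarithm modulo p and p^2\<close>

lemma recip_complement:
  assumes "i \<in> {1..2 * m}"
  shows "recip i + recip (CARD('p) - i) \<in> padic_ideal 1"
proof -
  have nd: "\<not> CARD('p) dvd i" "\<not> CARD('p) dvd CARD('p) - i"
    using assms p by (auto dest: dvd_imp_le)
  have "i \<noteq> 0" "CARD('p) - i \<noteq> 0" using assms p by auto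
  then have "(of_nat i :: 'p padic) \<noteq> 0" "(of_nat (CARD('p) - i) :: 'p padic) \<noteq> 0"
    by (simp_all only: of_nat_eq_0_iff not_False_eq_True)
  moreover have "of_nat CARD('p) = (of_nat i + of_nat (CARD('p) - i) :: 'p padic)"
    using assms p by (simp flip: of_nat_add)
  ultimately have "recip i + recip (CARD('p) - i)
      = of_nat CARD('p) / (of_nat i * of_nat (CARD('p) - i))"
    unfolding recip_def by (simp only:) (simp add: field_simps)
  moreover have "of_nat CARD('p) / (of_nat i * of_nat (CARD('p) - i)) \<in> (padic_ideal 1 :: 'p padic set)"
    by (intro padic_ideal_divide of_nat_CARD_in_padic_ideal)
       (simp only: padic_norm_mult padic_norm_of_nat_coprime[OF nd(1)] padic_norm_of_nat_coprime[OF nd(2)] mult_1)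
  ultimately show ?thesis by (simp only:)
qed

lemma fermat_cong:
  assumes "padic_norm x = 1"
  shows "x ^ (2 * m) - 1 \<in> (padic_ideal 1 :: 'p padic set)"
  using padic_units_fermat[OF padic_unitsI[OF assms]] by (simp add: p)

text \<open>In the product of the two sums, the pairs with i+k \<le> 2m give the terms in z^n. The
  pairs with i+k > 2m match the terms in z^(p-n), up to sign modulo p, after replacing (i, k) by
  (p-i, 2m-k): 1/(p-i) is -1/i, V is symmetric, and z^(2m) is 1.\<close>

lemma sum_VL_power:
  assumes z: "padic_norm z = 1"
  shows "(\<Sum>n\<le>2 * m. VL n * (z ^ n - z ^ (CARD('p) - n)))
    - (\<Sum>i\<le>2 * m. recip i * z ^ i) * (\<Sum>n\<le>2 * m. V n * z ^ n) \<in> padic_ideal 1"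
proof -
  have zi: "z \<in> padic_ints" using z by (simp add: padic_ints_def)
  \<comment> \<open>Terms with i = 0 vanish as \<open>recip 0 = 0\<close>; they must go before the
    reflection, which would send i = 0 to p.\<close>
  have drop0: "(\<Sum>i\<le>2 * m. \<Sum>k\<in>A i. recip i * g i k) = (\<Sum>i\<in>{1..2 * m}. \<Sum>k\<in>A i. recip i * g i k)"
    for g :: "nat \<Rightarrow> nat \<Rightarrow> 'p padic" and A
    unfolding sum_atMost_split_0 by (simp add: recip_def)
  have "(\<Sum>i\<le>2 * m. recip i * z ^ i) * (\<Sum>n\<le>2 * m. V n * z ^ n)
      = (\<Sum>i\<le>2 * m. \<Sum>k\<le>2 * m. recip i * (V k * z ^ (i + k)))"
    unfolding sum_product by (simp add: power_add ac_simps)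
  also have "\<dots> = (\<Sum>i\<le>2 * m. \<Sum>k\<le>2 * m - i. recip i * (V k * z ^ (i + k)))
      + (\<Sum>i\<le>2 * m. \<Sum>k\<in>{2 * m - i<..2 * m}. recip i * (V k * z ^ (i + k)))"
    unfolding sum.distrib[symmetric]
  proof (rule sum.cong[OF refl])
    fix i
    have "{..2 * m} = {..2 * m - i} \<union> {2 * m - i<..2 * m}" by auto
    then show "(\<Sum>k\<le>2 * m. recip i * (V k * z ^ (i + k))) = (\<Sum>k\<le>2 * m - i. recip i * (V k * z ^ (i + k)))
      + (\<Sum>k\<in>{2 * m - i<..2 * m}. recip i * (V k * z ^ (i + k)))"
      by (simp only:) (rule sum.union_disjoint, auto)
  qed
  also have "(\<Sum>i\<le>2 * m. \<Sum>k\<in>{2 * m - i<..2 * m}. recip i * (V k * z ^ (i + k)))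
      = (\<Sum>i\<in>{1..2 * m}. \<Sum>k\<in>{2 * m - i<..2 * m}. recip i * (V k * z ^ (i + k)))" by (rule drop0)
  also have "(\<Sum>i\<le>2 * m. \<Sum>k\<le>2 * m - i. recip i * (V k * z ^ (i + k))) = (\<Sum>n\<le>2 * m. VL n * z ^ n)"
    unfolding sum_triangle_diagonal[symmetric] VL_def sum_distrib_right
    by (simp add: mult.assoc)
  finally have LV: "(\<Sum>i\<le>2 * m. recip i * z ^ i) * (\<Sum>n\<le>2 * m. V n * z ^ n) = (\<Sum>n\<le>2 * m. VL n * z ^ n)
      + (\<Sum>i\<in>{1..2 * m}. \<Sum>k\<in>{2 * m - i<..2 * m}. recip i * (V k * z ^ (i + k)))" .
  have "(\<Sum>n\<le>2 * m. VL n * z ^ (CARD('p) - n))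
      = (\<Sum>n\<le>2 * m. \<Sum>i\<le>n. recip i * (V (n - i) * z ^ (CARD('p) - (i + (n - i)))))"
    unfolding VL_def sum_distrib_right by (simp add: mult.assoc)
  also have "\<dots> = (\<Sum>i\<le>2 * m. \<Sum>k\<le>2 * m - i. recip i * (V k * z ^ (CARD('p) - (i + k))))"
    by (rule sum_triangle_diagonal)
  also have "\<dots> = (\<Sum>i\<in>{1..2 * m}. \<Sum>k\<le>2 * m - i. recip i * (V k * z ^ (CARD('p) - (i + k))))"
    by (rule drop0)
  also have "\<dots> = (\<Sum>i\<in>{1..2 * m}. \<Sum>k\<in>{2 * m - i<..2 * m}.
      recip (CARD('p) - i) * (V (2 * m - k) * z ^ (i + k - 2 * m)))"
    unfolding sum.Sigma[OF finite_atLeastAtMost ballI[OF finite_atMost]]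
      sum.Sigma[OF finite_atLeastAtMost ballI[OF finite_greaterThanAtMost]]
    by (intro sum.reindex_bij_witness[of _ "\<lambda>(i, k). (CARD('p) - i, 2 * m - k)" "\<lambda>(i, k). (CARD('p) - i, 2 * m - k)"])
       (auto simp: p)
  finally have rev: "(\<Sum>n\<le>2 * m. VL n * z ^ (CARD('p) - n)) = (\<Sum>i\<in>{1..2 * m}. \<Sum>k\<in>{2 * m - i<..2 * m}.
      recip (CARD('p) - i) * (V (2 * m - k) * z ^ (i + k - 2 * m)))" .
  have "(\<Sum>i\<in>{1..2 * m}. \<Sum>k\<in>{2 * m - i<..2 * m}. recip i * (V k * z ^ (i + k))
      + recip (CARD('p) - i) * (V (2 * m - k) * z ^ (i + k - 2 * m))) \<in> padic_ideal 1"
  proof (intro padic_ideal_sum)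
    fix i k assume i: "i \<in> {1..2 * m}" and k: "k \<in> {2 * m - i<..2 * m}"
    define r r' v v' y where "r = recip i" and "r' = recip (CARD('p) - i)" and "v = V k"
      and "v' = V (2 * m - k)" and "y = z ^ (i + k - 2 * m)"
    have "i + k = 2 * m + (i + k - 2 * m)" using i k by auto
    then have y: "z ^ (i + k) = y * z ^ (2 * m)" by (metis y_def power_add mult.commute)
    have r: "r \<in> padic_ints" "r' \<in> padic_ints" using i p unfolding r_def r'_def by (auto intro!: recip_ints)
    have v: "v \<in> padic_ints" "v' \<in> padic_ints" using k unfolding v_def v'_def by (auto intro!: V_ints)
    have yi: "y \<in> padic_ints" unfolding y_def by (rule padic_ints_power[OF zi])
    have rr: "r + r' \<in> padic_ideal 1" unfolding r_def r'_def by (rule recip_complement[OF i])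
    have vv: "v - v' \<in> padic_ideal 1" unfolding v_def v'_def using k by (intro V_symmetric) auto
    have "r * (v * z ^ (i + k)) + r' * (v' * y)
        = r * v * y * (z ^ (2 * m) - 1) + r * y * (v - v') + (r + r') * (v' * y)"
      unfolding y by (simp add: algebra_simps)
    moreover have "\<dots> \<in> padic_ideal 1"
      using padic_ideal_mult_left[OF padic_ints_mult[OF padic_ints_mult[OF r(1) v(1)] yi] fermat_cong[OF z]]
        padic_ideal_mult_left[OF padic_ints_mult[OF r(1) yi] vv]
        padic_ideal_mult_right[OF rr padic_ints_mult[OF v(2) yi]]
      by (intro padic_ideal_add)
    ultimately show "recip i * (V k * z ^ (i + k))
      + recip (CARD('p) - i) * (V (2 * m - k) * z ^ (i + k - 2 * m)) \<in> padic_ideal 1"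
      by (simp add: r_def r'_def v_def v'_def y_def)
  qed
  note padic_ideal_uminus[OF this]
  moreover have "x - b - (x + a) = - (a + b)" for x a b :: "'p padic" by simp
  ultimately show ?thesis
    unfolding right_diff_distrib sum_subtractf LV rev sum.distrib by (simp only:)
qed

text \<open>In the expansion of (1-z)^p, the outer terms are 1 and -z^p since p is odd, and each
  inner coefficient is congruent to -p/i modulo p^2.\<close>

lemma truncated_log_cong:
  "of_nat CARD('p) * (\<Sum>i\<le>2 * m. recip i * z ^ i) + (z * (z ^ (2 * m) - 1) + (1 - z) * ((1 - z) ^ (2 * m) - 1))
    \<in> padic_ideal 2" if z: "z \<in> (padic_ints :: 'p padic set)"
proof -
  let ?B = "bincoeff (of_nat CARD('p)) :: nat \<Rightarrow> 'p padic"
  have "(1 - z) ^ CARD('p) = (\<Sum>i\<le>2 * m. ?B i * z ^ i) + ?B CARD('p) * z ^ CARD('p)"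
    unfolding power_one_minus_eq_sum by (simp add: p)
  also have "?B CARD('p) = - 1" using p unfolding bincoeff_of_nat by simp
  also have "(\<Sum>i\<le>2 * m. ?B i * z ^ i) = 1 + (\<Sum>i\<in>{1..2 * m}. ?B i * z ^ i)"
    unfolding sum_atMost_split_0 by (simp add: bincoeff_def)
  finally have "(1 - z) * (1 - z) ^ (2 * m) = 1 + (\<Sum>i\<in>{1..2 * m}. ?B i * z ^ i) - z * z ^ (2 * m)"
    by (simp add: p)
  moreover have "of_nat CARD('p) * (\<Sum>i\<le>2 * m. recip i * z ^ i)
      = (\<Sum>i\<in>{1..2 * m}. of_nat CARD('p) / of_nat i * z ^ i)"
    unfolding sum_atMost_split_0 by (simp add: recip_def sum_distrib_left)
  ultimately have eq: "of_nat CARD('p) * (\<Sum>i\<le>2 * m. recip i * z ^ i)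
      + (z * (z ^ (2 * m) - 1) + (1 - z) * ((1 - z) ^ (2 * m) - 1))
      = (\<Sum>i\<in>{1..2 * m}. (?B i + of_nat CARD('p) / of_nat i) * z ^ i)"
    by (simp only: right_diff_distrib distrib_right sum.distrib) simp
  have "?B i + of_nat CARD('p) / of_nat i \<in> padic_ideal 2" if "i \<in> {1..2 * m}" for i
    using bincoeff_CARD_mult_cong[of "1 :: 'p padic" i] that p by simp
  then show ?thesis
    unfolding eq by (intro padic_ideal_sum padic_ideal_mult_right padic_ints_power z)
qed

section \<open>Assembling the congruence at z and 1/z\<close>

lemma reverse_power_sum:
  assumes "(z :: 'p padic) \<noteq> 0"
  shows "z ^ (2 * m) * (\<Sum>n\<le>2 * m. g n * (1 / z) ^ n) = (\<Sum>n\<le>2 * m. g n * z ^ (2 * m - n))"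
  unfolding sum_distrib_left
proof (rule sum.cong[OF refl])
  fix n assume "n \<in> {..2 * m}"
  then have "z ^ (2 * m) = z ^ (2 * m - n) * z ^ n" by (simp flip: power_add)
  then show "z ^ (2 * m) * (g n * (1 / z) ^ n) = g n * z ^ (2 * m - n)"
    using assms by (simp add: power_divide)
qed

text \<open>The theorem with both p-adic powers replaced by their first order expansions. It is
  proved after multiplication by the unit \<open>w\<close>, which turns the series values into
  \<open>A\<close>, \<open>A'\<close> and \<open>K\<close>, the values accessible through the
  polynomials of V and Q.\<close>

lemma truncated_transformation:
  assumes z: "padic_norm z = 1" and z1: "padic_norm (1 - z) = 1"
  defines "F \<equiv> \<lambda>x. \<Sum>n\<le>2 * m. hyp_coeff \<alpha> n * x ^ n"
    and "G \<equiv> \<Sum>k\<le>2 * m. quad_coeff \<alpha> k * (z / (1 - z)\<^sup>2) ^ k"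
  shows "F z - z ^ Suc a * (1 - t * (z ^ (2 * m) - 1)) * F (1 / z)
    - (1 - z) ^ Suc a * (1 - t * ((1 - z) ^ (2 * m) - 1)) * G \<in> padic_ideal 2"
proof -
  define U where "U x = (\<Sum>n\<le>2 * m. V n * x ^ n)" for x
  define P where "P x = (\<Sum>n\<le>2 * m. Q n * x ^ n)" for x
  define L where "L = (\<Sum>i\<le>2 * m. recip i * z ^ i)"
  define e where "e n = z ^ n - z ^ (CARD('p) - n)" for n
  define w where "w = (1 - z) ^ (2 * m - a)"
  define A where "A = w * F z"
  define A' where "A' = w * z ^ a * F (1 / z)"
  define K where "K = (1 - z) ^ (2 * m) * G"
  define h where "h = z ^ (2 * m) - 1"
  define h' where "h' = (1 - z) ^ (2 * m) - 1"
  define s where "s = (of_nat CARD('p) * t :: 'p padic)"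
  have nz: "z \<noteq> 0" "1 - z \<noteq> 0" using z z1 by auto
  have ints: "z \<in> padic_ints" "1 - z \<in> padic_ints" "1 / z \<in> padic_ints"
    using z z1 padic_ints_divide[OF padic_ints_1 z] by (auto simp: padic_ints_def)
  have norm_inv: "padic_norm (1 - 1 / z) = 1"
  proof -
    have "z * (1 - 1 / z) = - (1 - z)" using nz by (simp add: field_simps)
    then have "padic_norm z * padic_norm (1 - 1 / z) = padic_norm (1 - z)"
      by (metis padic_norm_mult padic_norm_minus)
    then show ?thesis using z z1 by simp
  qed
  \<comment> \<open>Passing from z to 1/z costs a sign in 1-z, which disappears in the exponents 2m
    and 2m-a, both even.\<close>
  have even_pow: "(z * (1 - 1 / z)) ^ (2 * j) = (1 - z) ^ (2 * j)" for j
  proof -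
    have "z * (1 - 1 / z) = - (1 - z)" using nz by (simp add: field_simps)
    then show ?thesis by (simp only: power_mult power2_minus)
  qed
  have z2m: "z ^ (2 * m) \<in> padic_ints" by (intro padic_ints_power ints)
  have 2: "x \<in> padic_ideal 2 \<Longrightarrow> x \<in> (padic_ideal 1 :: 'p padic set)" for x
    using padic_ideal_antimono[of 1 2] by auto
  have UA: "U z - A \<in> padic_ideal 2"
    using sum_V_power[OF ints(1)] by (simp only: U_def A_def w_def F_def)
  have UA': "z ^ (2 * m) * U (1 / z) - A' \<in> padic_ideal 2"
  proof -
    obtain c where "a = 2 * c" using a by auto
    then have "2 * m - a = 2 * (m - c)" by simp
    then obtain b where b: "2 * m - a = 2 * b" ..
    have "2 * m = a + 2 * b" using a b by simp
    then have "z ^ (2 * m) * (1 - 1 / z) ^ (2 * m - a) = z ^ a * (z * (1 - 1 / z)) ^ (2 * b)"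
      unfolding b power_mult_distrib by (simp only: power_add mult.assoc)
    then have "z ^ (2 * m) * (1 - 1 / z) ^ (2 * m - a) = w * z ^ a"
      unfolding even_pow w_def b by simp
    then have "z ^ (2 * m) * (U (1 / z) - (1 - 1 / z) ^ (2 * m - a) * F (1 / z)) = z ^ (2 * m) * U (1 / z) - A'"
      by (simp only: A'_def right_diff_distrib mult.assoc[symmetric])
    moreover note padic_ideal_mult_left[OF z2m, of "U (1 / z) - (1 - 1 / z) ^ (2 * m - a) * F (1 / z)" 2]
    moreover have "U (1 / z) - (1 - 1 / z) ^ (2 * m - a) * F (1 / z) \<in> padic_ideal 2"
      using sum_V_power[OF ints(3)] by (simp only: U_def F_def)
    ultimately show ?thesis by (simp only:)
  qed
  have PK: "P z - K \<in> padic_ideal 2"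
    using sum_Q_power[OF ints(1) z1] by (simp only: P_def K_def G_def)
  \<comment> \<open>The argument z/(1-z)^2 is invariant under z -> 1/z, so the same \<open>K\<close>
    serves both points.\<close>
  have PK': "z ^ (2 * m) * P (1 / z) - K \<in> padic_ideal 2"
  proof -
    have "(1 / z) / (1 - 1 / z)\<^sup>2 = z / (1 - z)\<^sup>2"
    proof -
      have "(z * (1 - 1 / z))\<^sup>2 = (1 - z)\<^sup>2" using even_pow[of 1] by simp
      then have "(1 - z)\<^sup>2 = z * z * (1 - 1 / z)\<^sup>2" by (simp only: power_mult_distrib power2_eq_square[of z])
      then show ?thesis using nz by simp
    qed
    moreover have "z ^ (2 * m) * (1 - 1 / z) ^ (2 * m) = (1 - z) ^ (2 * m)"
      using even_pow[of m] by (simp only: power_mult_distrib)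
    ultimately have "z ^ (2 * m) * (P (1 / z) - (1 - 1 / z) ^ (2 * m) *
        (\<Sum>k\<le>2 * m. quad_coeff \<alpha> k * ((1 / z) / (1 - 1 / z)\<^sup>2) ^ k)) = z ^ (2 * m) * P (1 / z) - K"
      by (simp only: K_def G_def right_diff_distrib mult.assoc[symmetric])
    moreover note padic_ideal_mult_left[OF z2m, of "P (1 / z) - (1 - 1 / z) ^ (2 * m) *
        (\<Sum>k\<le>2 * m. quad_coeff \<alpha> k * ((1 / z) / (1 - 1 / z)\<^sup>2) ^ k)" 2]
    moreover have "P (1 / z) - (1 - 1 / z) ^ (2 * m) *
        (\<Sum>k\<le>2 * m. quad_coeff \<alpha> k * ((1 / z) / (1 - 1 / z)\<^sup>2) ^ k) \<in> padic_ideal 2"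
      using sum_Q_power[OF ints(3) norm_inv] by (simp only: P_def)
    ultimately show ?thesis by (simp only:)
  qed
  have UP: "U x - P x \<in> padic_ideal 1" if "x \<in> padic_ints" for x
    unfolding U_def P_def sum_subtractf[symmetric] left_diff_distrib[symmetric]
    using that by (intro padic_ideal_sum padic_ideal_mult_right V_cong_Q_1 padic_ints_power) auto
  \<comment> \<open>Modulo p the values \<open>K\<close>, \<open>A'\<close> and \<open>U z\<close>
    coincide; they may be exchanged wherever a factor \<open>h\<close> or \<open>h'\<close> supplies
    another p.\<close>
  have KU: "K - U z \<in> padic_ideal 1"
    using padic_ideal_uminus[OF padic_ideal_add[OF UP[OF ints(1)] 2[OF PK]]] by simp
  have AU: "A' - U z \<in> padic_ideal 1"
  proof -
    have "z ^ (2 * m) * (U (1 / z) - P (1 / z)) \<in> padic_ideal 1"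
      by (intro padic_ideal_mult_left z2m UP ints)
    from padic_ideal_add[OF padic_ideal_diff[OF padic_ideal_add[OF this 2[OF PK']] 2[OF UA']] KU]
    show ?thesis by (simp add: algebra_simps)
  qed
  \<comment> \<open>As p-n = 1 + (2m-n), the weight \<open>e n\<close> compares a polynomial at z
    with its reversal. For V this gives A - z A', and for Q it gives (1-z) K, modulo p^2.\<close>
  have pair: "(\<Sum>n\<le>2 * m. g n * e n)
      = (\<Sum>n\<le>2 * m. g n * z ^ n) - z * (z ^ (2 * m) * (\<Sum>n\<le>2 * m. g n * (1 / z) ^ n))" for g
  proof -
    have "z * (\<Sum>n\<le>2 * m. g n * z ^ (2 * m - n)) = (\<Sum>n\<le>2 * m. g n * z ^ (CARD('p) - n))"
      unfolding sum_distrib_left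
      by (intro sum.cong) (auto simp: p Suc_diff_le)
    then show ?thesis
      unfolding reverse_power_sum[OF nz(1)] by (simp add: e_def right_diff_distrib sum_subtractf)
  qed
  have e_ints: "e n \<in> padic_ints" for n
    unfolding e_def by (intro padic_ints_diff padic_ints_power ints)
  have "(\<Sum>n\<le>2 * m. (V n - Q n - s * VL n) * e n) \<in> padic_ideal 2"
    unfolding s_def by (intro padic_ideal_sum padic_ideal_mult_right V_cong_Q e_ints) auto
  then have E1: "(U z - z * (z ^ (2 * m) * U (1 / z))) - (P z - z * (z ^ (2 * m) * P (1 / z)))
      - s * (\<Sum>n\<le>2 * m. VL n * e n) \<in> padic_ideal 2"
    unfolding U_def P_def pair[symmetric]
    by (simp only: left_diff_distrib sum_subtractf sum_distrib_left mult.assoc)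
  have E2: "s * ((\<Sum>n\<le>2 * m. VL n * e n) - L * U z) \<in> padic_ideal 2"
    unfolding s_def using sum_VL_power[OF z]
    by (intro padic_ideal_1_mult CARD_mult_t_ideal) (simp only: L_def U_def e_def)
  have Uz: "U z \<in> padic_ints"
    unfolding U_def by (intro padic_ints_sum padic_ints_mult V_ints padic_ints_power ints) auto
  have E3: "(of_nat CARD('p) * L + (z * h + (1 - z) * h')) * (t * U z) \<in> padic_ideal 2"
    unfolding L_def h_def h'_def
    by (intro padic_ideal_mult_right truncated_log_cong padic_ints_mult t Uz ints)
  have hh: "h \<in> padic_ideal 1" "h' \<in> padic_ideal 1"
    using fermat_cong z z1 by (auto simp: h_def h'_def)
  have E4: "t * z * (h * (A' - U z)) \<in> padic_ideal 2"
    by (intro padic_ideal_mult_left[OF padic_ints_mult] padic_ideal_1_mult hh AU t ints)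
  have E5: "t * (1 - z) * (h' * (K - U z)) \<in> padic_ideal 2"
    by (intro padic_ideal_mult_left[OF padic_ints_mult] padic_ideal_1_mult hh KU t ints)
  have E6: "z * (z ^ (2 * m) * U (1 / z) - A') \<in> padic_ideal 2"
    "z * (z ^ (2 * m) * P (1 / z) - K) \<in> padic_ideal 2"
    by (intro padic_ideal_mult_left ints UA' PK')+
  define U' where "U' = z ^ (2 * m) * U (1 / z)"
  define P' where "P' = z ^ (2 * m) * P (1 / z)"
  define S where "S = (\<Sum>n\<le>2 * m. VL n * e n)"
  define u where "u = U z"
  define q where "q = P z"
  \<comment> \<open>An exact identity: the logarithmic sum is replaced via \<open>E2\<close> and
    \<open>E3\<close> by terms in \<open>h\<close> and \<open>h'\<close> times \<open>u\<close>,
    where \<open>E4\<close> and \<open>E5\<close> then exchange \<open>u\<close> for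
    \<open>A'\<close> and \<open>K\<close>.\<close>
  have "A - z * A' - (1 - z) * K + t * (z * h * A' + (1 - z) * h' * K)
      = ((u - z * U') - (q - z * P') - s * S) + s * (S - L * u)
        + (of_nat CARD('p) * L + (z * h + (1 - z) * h')) * (t * u)
        + t * z * (h * (A' - u)) + t * (1 - z) * (h' * (K - u))
        - (u - A) + z * (U' - A') + (q - K) - z * (P' - K)"
    unfolding s_def by (simp add: algebra_simps)
  moreover have "\<dots> \<in> padic_ideal 2"
    unfolding U'_def P'_def S_def u_def q_def
    by (rule E1 E2 E3 E4 E5 E6 UA PK | rule padic_ideal_add padic_ideal_diff)+
  ultimately have main: "A - z * A' - (1 - z) * K + t * (z * h * A' + (1 - z) * h' * K) \<in> padic_ideal 2"
    by (simp only:)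
  \<comment> \<open>Hence \<open>w\<close> times (1-z)^(a+1) G is (1-z) K, and \<open>main\<close>
    is \<open>w\<close> times the claim.\<close>
  have w: "w * (1 - z) ^ a = (1 - z) ^ (2 * m)"
    unfolding w_def using a by (simp flip: power_add)
  have expand: "w * (b - z * y * c * b' - v * x * d * g) = w * b - z * c * (w * y * b') - v * d * (w * x * g)"
    for b b' c d g v x y by (simp add: algebra_simps)
  have "w * (F z - z ^ Suc a * (1 - t * h) * F (1 / z) - (1 - z) ^ Suc a * (1 - t * h') * G)
      = A - z * (1 - t * h) * A' - (1 - z) * (1 - t * h') * (w * (1 - z) ^ a * G)"
    unfolding A_def A'_def power_Suc by (rule expand)
  also have "\<dots> = A - z * A' - (1 - z) * K + t * (z * h * A' + (1 - z) * h' * K)"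
    unfolding w K_def[symmetric] by (simp add: algebra_simps)
  finally have "w * (F z - z ^ Suc a * (1 - t * h) * F (1 / z) - (1 - z) ^ Suc a * (1 - t * h') * G)
      \<in> padic_ideal 2" using main by (simp only:)
  moreover have "padic_norm w = 1" using z1 by (simp add: w_def padic_norm_power)
  ultimately show ?thesis
    unfolding h_def h'_def by (simp only: padic_ideal_mult_unit_iff)
qed

end

section \<open>Passage to the p-adic exponents\<close>

theorem theorem2p4:
  fixes p :: nat and \<alpha> z :: "'p::prime_card padic"
  assumes "p = CARD('p)" and "prime p" and "odd p"
    and "\<alpha> \<in> padic_ints" and "even (padic_residue (- \<alpha>))"
    and "z \<in> padic_units" and "\<not> padic_cong p z 1"
  shows "padic_cong (p ^ 2)
    (hyp2F1_trunc \<alpha> \<alpha> 1 z (p - 1)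
      - padic_power z ((1, 0) - padic_lambda \<alpha>) * hyp2F1_trunc \<alpha> \<alpha> 1 (1 / z) (p - 1))
    (padic_power (1 - z) ((1, 0) - padic_lambda \<alpha>)
      * hyp2F1_trunc (1 / 2 * \<alpha>) (1 / 2 - 1 / 2 * \<alpha>) 1 (- (4 * z / (1 - z) ^ 2)) (p - 1))"
proof -
  obtain m where m: "CARD('p) = Suc (2 * m)" using assms(1,3) by (auto elim: oddE)
  define a where "a = nat (padic_residue (- \<alpha>))"
  have res: "padic_residue (- \<alpha>) \<in> {0..<int CARD('p)}" "- \<alpha> - of_int (padic_residue (- \<alpha>)) \<in> padic_ideal 1"
    using padic_residue[OF padic_ints_uminus[OF assms(4)]] .
  then have a_res: "padic_residue (- \<alpha>) = int a" by (simp add: a_def)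
  have a: "even a" "a \<le> 2 * m" using assms(5) res(1) a_res m by auto
  have "\<alpha> + of_nat a \<in> padic_ideal 1" using padic_ideal_uminus[OF res(2)] by (simp add: a_res add.commute)
  then obtain t where t: "t \<in> padic_ints" "\<alpha> + of_nat a = of_nat CARD('p) ^ 1 * t"
    by (rule padic_idealE)
  have \<alpha>: "\<alpha> = of_nat CARD('p) * t - of_nat a" using t(2) by (simp add: algebra_simps)
  have "of_nat CARD('p) \<noteq> (0 :: 'p padic)" using m by (simp del: of_nat_Suc)
  \<comment> \<open>Here \<lambda> = -a + t(p-1), so the integer part a+1 of the exponent is a
    natural number, as \<open>padic_power_cong\<close> requires, and the p-adic part is -t.\<close>
  then have expo: "(1, 0) - padic_lambda \<alpha> = (int (Suc a), - t)"
    unfolding padic_lambda_def a_res using t(2) by simp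
  have z: "padic_norm z = 1" by (rule padic_unit_norm[OF assms(6)])
  have z1: "padic_norm (1 - z) = 1"
  proof (rule padic_norm_eq_1I)
    show "1 - z \<in> padic_ints" using assms(6) by (intro padic_ints_diff) (auto simp: padic_units_def)
    show "1 - z \<notin> padic_ideal 1"
      using assms(1,7) padic_cong_iff_ideal[of 1 z 1] padic_ideal_uminus[of "1 - z" 1] by auto
  qed
  define h where "h = z ^ (2 * m) - 1"
  define h' where "h' = (1 - z) ^ (2 * m) - 1"
  define F where "F x = (\<Sum>n\<le>2 * m. hyp_coeff \<alpha> n * x ^ n)" for x
  define G where "G = (\<Sum>k\<le>2 * m. quad_coeff \<alpha> k * (z / (1 - z)\<^sup>2) ^ k)"
  define A where "A = padic_power z ((1, 0) - padic_lambda \<alpha>)"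
  define B where "B = padic_power (1 - z) ((1, 0) - padic_lambda \<alpha>)"
  have main: "F z - z ^ Suc a * (1 - t * h) * F (1 / z) - (1 - z) ^ Suc a * (1 - t * h') * G \<in> padic_ideal 2"
    unfolding F_def G_def h_def h'_def by (rule truncated_transformation[OF m a t(1) \<alpha> z z1])
  have F: "hyp2F1_trunc \<alpha> \<alpha> 1 x (p - 1) = F x" for x
    unfolding hyp2F1_trunc_def assms(1) m F_def hyp_coeff_def
    by (intro sum.cong) (auto simp: pochhammer_fact[symmetric] power2_eq_square)
  have G: "hyp2F1_trunc (1 / 2 * \<alpha>) (1 / 2 - 1 / 2 * \<alpha>) 1 (- (4 * z / (1 - z) ^ 2)) (p - 1) = G"
  proof -
    have pow: "(- (4 * z / (1 - z)\<^sup>2)) ^ k = (-4) ^ k * (z / (1 - z)\<^sup>2) ^ k" for k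
      by (simp flip: power_mult_distrib)
    have half: "1 / 2 * \<alpha> = \<alpha> / 2" "1 / 2 - \<alpha> / 2 = (1 - \<alpha>) / 2"
      by (simp_all add: diff_divide_distrib)
    show ?thesis
      unfolding hyp2F1_trunc_def assms(1) m G_def quad_coeff_def half pow
      by (intro sum.cong) (auto simp: pochhammer_fact[symmetric] power2_eq_square)
  qed
  have A: "A - z ^ Suc a * (1 - t * h) \<in> padic_ideal 2"
    using padic_power_cong[OF assms(6) padic_ints_uminus[OF t(1)], of "Suc a"] m
    unfolding A_def expo h_def by simp
  have B: "B - (1 - z) ^ Suc a * (1 - t * h') \<in> padic_ideal 2"
    using padic_power_cong[OF padic_unitsI[OF z1] padic_ints_uminus[OF t(1)], of "Suc a"] m
    unfolding B_def expo h'_def by simp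
  \<comment> \<open>Integrality of \<open>F (1 / z)\<close> and \<open>G\<close> allows the two
    powers in front of them to be replaced modulo p^2.\<close>
  have "1 / z \<in> padic_ints" "z / (1 - z)\<^sup>2 \<in> padic_ints"
    using assms(6) z z1
    by (intro padic_ints_divide; simp add: padic_norm_power padic_units_def)+
  then have ints: "F (1 / z) \<in> padic_ints" "G \<in> padic_ints"
    unfolding F_def G_def
    using hyp_coeff_ints[OF m a t(1) \<alpha>] quad_coeff_ints[OF m a t(1) \<alpha>]
    by (auto intro!: padic_ints_sum padic_ints_mult padic_ints_power)
  have "F z - A * F (1 / z) - B * G
      = (F z - z ^ Suc a * (1 - t * h) * F (1 / z) - (1 - z) ^ Suc a * (1 - t * h') * G)
        - (A - z ^ Suc a * (1 - t * h)) * F (1 / z) - (B - (1 - z) ^ Suc a * (1 - t * h')) * G"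
    by (simp add: algebra_simps)
  then have "F z - A * F (1 / z) - B * G \<in> padic_ideal 2"
    using main A B ints by (simp only: padic_ideal_diff padic_ideal_mult_right)
  then show ?thesis
    unfolding F G A_def[symmetric] B_def[symmetric] unfolding assms(1) padic_cong_iff_ideal .
qed

end
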